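(* Let $\Omega_1\subseteq\Omega_2\subseteq\cdots\subseteq\Omega_d$ be compact intervals of $\mathbb{R}$, $\Omega=\Omega_1\times\cdots\times\Omega_d$, and let $f:\mathbb{R}^d\to\mathbb{R}$ be continuous. Given $\boldsymbol{\nu}=(\nu_1,\dots,\nu_d)\in\mathcal{P}(\Omega_1)\times\cdots\times\mathcal{P}(\Omega_d)$, let $R_{\boldsymbol{\nu}}=\inf\{\varepsilon\ge0:\mathcal{M}_{\boldsymbol{\nu}}(\varepsilon)\ne\varnothing\}$ and $I_{\boldsymbol{\nu}}(\varepsilon)=\sup_{\pi\in\mathcal{M}_{\boldsymbol{\nu}}(\varepsilon)}\mathbb{E}_\pi[f(\mathbf{X})]$. Then $I_{\boldsymbol{\nu}}(\varepsilon)$ is both concave and continuous as a function of $\varepsilon\in(R_{\boldsymbol{\nu}},+\infty)$. Moreover, if $\nu_1\preceq_c\cdots\preceq_c\nu_d$, then $I_{\boldsymbol{\nu}}(\varepsilon)$ is a continuous function of $\varepsilon\in[0,+\infty)$.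
   Context: $\mathcal{P}(S)$ is the set of Borel probability measures on $S$. $\mathbf{X}=(X_1,\dots,X_d)$ is the canonical (identity) map on $\Omega$, $\mathbb{E}_\pi$ is expectation when $\mathbf{X}\sim\pi$. $\mathcal{M}(\Omega)$ is the set of martingale measures on $\Omega$: all $\pi\in\mathcal{P}(\Omega)$ with $\mathbb{E}_\pi[X_{k+1}\mid\sigma(X_1,\dots,X_k)]=X_k$ $\pi$-a.e. for $1\le k\le d-1$. $\Pi(\boldsymbol{\nu})$ is the set of probability measures on $\Omega$ whose $i$-th marginal is $\nu_i$ for $1\le i\le d$. $\mathcal{W}(\mu,\nu)=\inf\{\int\|\mathbf{x}-\mathbf{y}\|_1\,\pi(d\mathbf{x},d\mathbf{y})\}$, the infimum over couplings $\pi$ of $\mu$ and $\nu$, is the Wasserstein distance with $\ell_1$ cost. $d(\pi,\Pi(\boldsymbol{\nu}))=\inf\{\mathcal{W}(\pi,\pi'):\pi'\in\Pi(\boldsymbol{\nu})\}$. $\mathcal{M}_{\boldsymbol{\nu}}(\varepsilon)=\{\pi\in\mathcal{M}(\Omega):d(\pi,\Pi(\boldsymbol{\nu}))\le\varepsilon\}$. Convex order: $\mu\preceq_c\nu$ means $\int\phi\,d\mu\le\int\phi\,d\nu$ for every convex $\phi$ with linear growth at infinity. *)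

theory Defs
  imports "HOL-Probability.Probability"
begin

(* Points of R^d are the extensional functions in {1..d} \<rightarrow>\<^sub>E UNIV, so that the coordinates
   X_1, ..., X_d are x 1, ..., x d.  Since {1..d} is finite and every factor is second countable,
   this product sigma-algebra is the Borel sigma-algebra of Omega_1 x ... x Omega_d.  The set P(S)
   is space (prob_algebra S), S being taken with its Borel sigma-algebra. *)
definition path_space :: "nat \<Rightarrow> (nat \<Rightarrow> real set) \<Rightarrow> (nat \<Rightarrow> real) measure" where
  "path_space d \<Omega> = PiM {1..d} (\<lambda>i. restrict_space borel (\<Omega> i))"

definition coord_sigma :: "(nat \<Rightarrow> real) measure \<Rightarrow> nat \<Rightarrow> (nat \<Rightarrow> real) measure" where
  "coord_sigma \<pi> k =
     sigma (space \<pi>) (\<Union>i\<in>{1..k}. {(\<lambda>x. x i) -` A \<inter> space \<pi> | A. A \<in> sets borel})"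

definition martingale_measures :: "nat \<Rightarrow> (nat \<Rightarrow> real set) \<Rightarrow> (nat \<Rightarrow> real) measure set" where
  "martingale_measures d \<Omega> =
     {\<pi> \<in> space (prob_algebra (path_space d \<Omega>)).
        \<forall>k\<in>{1..<d}. AE x in \<pi>. real_cond_exp \<pi> (coord_sigma \<pi> k) (\<lambda>y. y (Suc k)) x = x k}"

definition measures_with_marginals ::
    "nat \<Rightarrow> (nat \<Rightarrow> real set) \<Rightarrow> (nat \<Rightarrow> real measure) \<Rightarrow> (nat \<Rightarrow> real) measure set" where
  "measures_with_marginals d \<Omega> \<nu> =
     {\<pi> \<in> space (prob_algebra (path_space d \<Omega>)).
        \<forall>i\<in>{1..d}. distr \<pi> (restrict_space borel (\<Omega> i)) (\<lambda>x. x i) = \<nu> i}"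

definition couplings :: "'a measure \<Rightarrow> 'b measure \<Rightarrow> ('a \<times> 'b) measure set" where
  "couplings \<mu> \<nu> =
     {\<gamma> \<in> space (prob_algebra (\<mu> \<Otimes>\<^sub>M \<nu>)). distr \<gamma> \<mu> fst = \<mu> \<and> distr \<gamma> \<nu> snd = \<nu>}"

definition wasserstein ::
    "nat \<Rightarrow> (nat \<Rightarrow> real) measure \<Rightarrow> (nat \<Rightarrow> real) measure \<Rightarrow> ennreal" where
  "wasserstein d \<mu> \<nu> =
     (INF \<gamma>\<in>couplings \<mu> \<nu>. \<integral>\<^sup>+ (x, y). ennreal (\<Sum>i=1..d. \<bar>x i - y i\<bar>) \<partial>\<gamma>)"

definition wasserstein_to_set ::
    "nat \<Rightarrow> (nat \<Rightarrow> real) measure \<Rightarrow> (nat \<Rightarrow> real) measure set \<Rightarrow> ennreal" where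
  "wasserstein_to_set d \<pi> A = (INF \<pi>'\<in>A. wasserstein d \<pi> \<pi>')"

(* Only used for eps >= 0: ennreal truncates negative reals to 0. *)
definition relaxed_martingale_measures ::
    "nat \<Rightarrow> (nat \<Rightarrow> real set) \<Rightarrow> (nat \<Rightarrow> real measure) \<Rightarrow> real \<Rightarrow> (nat \<Rightarrow> real) measure set" where
  "relaxed_martingale_measures d \<Omega> \<nu> \<epsilon> =
     {\<pi> \<in> martingale_measures d \<Omega>.
        wasserstein_to_set d \<pi> (measures_with_marginals d \<Omega> \<nu>) \<le> ennreal \<epsilon>}"

definition critical_radius :: "nat \<Rightarrow> (nat \<Rightarrow> real set) \<Rightarrow> (nat \<Rightarrow> real measure) \<Rightarrow> real" where
  "critical_radius d \<Omega> \<nu> = Inf {\<epsilon>. 0 \<le> \<epsilon> \<and> relaxed_martingale_measures d \<Omega> \<nu> \<epsilon> \<noteq> {}}"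

definition relaxed_value ::
    "nat \<Rightarrow> (nat \<Rightarrow> real set) \<Rightarrow> (nat \<Rightarrow> real measure) \<Rightarrow> ((nat \<Rightarrow> real) \<Rightarrow> real) \<Rightarrow> real \<Rightarrow> real" where
  "relaxed_value d \<Omega> \<nu> f \<epsilon> =
     (SUP \<pi>\<in>relaxed_martingale_measures d \<Omega> \<nu> \<epsilon>. \<integral>x. f x \<partial>\<pi>)"

definition convex_order :: "real measure \<Rightarrow> real measure \<Rightarrow> bool" where
  "convex_order \<mu> \<nu> \<longleftrightarrow>
     (\<forall>\<phi>::real \<Rightarrow> real. convex_on UNIV \<phi> \<and> (\<exists>C. \<forall>x. \<bar>\<phi> x\<bar> \<le> C * (1 + \<bar>x\<bar>)) \<longrightarrow>
        (\<integral>x. \<phi> x \<partial>\<mu>) \<le> (\<integral>x. \<phi> x \<partial>\<nu>))"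

end

theory Submission
  imports Defs
begin

text \<open>
  Everything rests on convexity and compactness. Mixtures of martingale laws are martingale laws,
  mixtures of couplings are couplings, and the transport cost is affine in the coupling. Hence near
  optimal competitors at radii \<epsilon> and \<delta> mix to a competitor at the mixed radius
  (mixture_relaxed), so the value function is concave wherever the feasible sets are nonempty, and a
  concave function on an open half line is continuous.

  The value function is nondecreasing, so on [0, \<infinity>) only right continuity at 0 remains. Near
  optimal competitors at radii 1/n have a weakly convergent subsequence. Its limit is again a
  martingale and has the prescribed marginals, so it competes at radius 0 (relaxed_limit). This uses
  three facts about laws on a box of paths. The martingale property says that the integrals of certain
  continuous functions vanish (martingales_iff), so it survives weak limits. A law on the line is
  determined by the integrals of the hinges \<bar>x - q\<bar> (distr_eq_if_hinges_eq), and these are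
  Lipschitz, hence controlled by the transport cost. Laws on a box are sequentially compact
  (laws_sequentially_compact): a space-filling curve with a Borel section transfers the problem to the
  line, where Helly's theorem applies.

  It also needs a feasible law at radius 0, which is Strassen's theorem for the chain of marginals in
  convex order (strassen). For finitely many hinges, let \<rho> be a martingale law that minimises the
  squared error J between the hinge integrals of its marginals and those of \<nu>. The first order
  condition at \<rho> provides Lipschitz functions g_1, ..., g_d such that every martingale law \<pi> satisfies
  \<Sum>i. E_\<pi> g_i(X_i) \<ge> J(\<rho>) + \<Sum>i. \<integral> g_i d\<nu>_i. On the other hand, dynamic programming
  produces a martingale law with \<Sum>i. E_\<pi> g_i(X_i) \<le> \<Sum>i. \<integral> g_i d\<nu>_i up to an arbitrarily
  small error (martingale_below_marginals). The two inequalities force J(\<rho>) = 0. Compactness then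
  matches all hinges simultaneously.
\<close>

section \<open>Laws on a box of paths\<close>

abbreviation path_continuous :: "nat \<Rightarrow> ((nat \<Rightarrow> real) \<Rightarrow> real) \<Rightarrow> bool" where
  "path_continuous d f \<equiv> continuous_map (product_topology (\<lambda>_. euclideanreal) {1..d}) euclideanreal f"

lemma path_continuous_coord:
  assumes "i \<in> {1..d}" "continuous_on UNIV \<phi>"
  shows "path_continuous d (\<lambda>x. \<phi> (x i))"
  using continuous_map_compose[OF continuous_map_product_projection[OF assms(1), of "\<lambda>_. euclideanreal"],
      of euclideanreal \<phi>] assms(2)
  by (simp add: o_def)

lemma path_continuous_coord_id: "i \<in> {1..d} \<Longrightarrow> path_continuous d (\<lambda>x. x i)"
  using path_continuous_coord[of i d "\<lambda>x. x"] by simp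

text \<open>
  The Borel sets of a function space over all of \<nat> are those of the countable product; a function of
  finitely many coordinates becomes one on that space by restriction.
\<close>

lemma borel_measurable_path_continuous:
  assumes "path_continuous d f"
  shows "f \<in> borel_measurable (path_space d \<Omega>)"
proof -
  define e :: "(nat \<Rightarrow> real) \<Rightarrow> nat \<Rightarrow> real" where "e x = restrict x {1..d}" for x
  have "continuous_map (product_topology (\<lambda>_. euclideanreal) UNIV)
          (product_topology (\<lambda>_. euclideanreal) {1..d}) e"
    unfolding continuous_map_componentwise e_def
    by (auto intro!: continuous_map_eq[OF continuous_map_product_projection])
  then have "continuous_map (product_topology (\<lambda>_. euclideanreal) UNIV) euclideanreal (f \<circ> e)"
    using assms by (rule continuous_map_compose)
  then have "continuous_on UNIV (f \<circ> e)"
    unfolding euclidean_product_topology by simp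
  then have [measurable]: "f \<circ> e \<in> borel_measurable borel"
    by (rule borel_measurable_continuous_onI)
  have coord: "(\<lambda>x. x i) \<in> borel_measurable (path_space d \<Omega>)" for i
  proof (cases "i \<in> {1..d}")
    case True
    then have "(\<lambda>x. x i) \<in> path_space d \<Omega> \<rightarrow>\<^sub>M restrict_space borel (\<Omega> i)"
      unfolding path_space_def by (intro measurable_component_singleton)
    then show ?thesis
      by (rule measurable_compose) (simp add: measurable_restrict_space1)
  next
    case False
    then have "(\<lambda>x. x i) \<in> borel_measurable (path_space d \<Omega>) \<longleftrightarrow> (\<lambda>x. undefined::real) \<in> borel_measurable (path_space d \<Omega>)"
      by (intro measurable_cong) (auto simp: path_space_def space_PiM PiE_def extensional_def)
    then show ?thesis by simp
  qed
  have "(\<lambda>x. x) \<in> path_space d \<Omega> \<rightarrow>\<^sub>M (PiM UNIV (\<lambda>_. borel))"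
    by (rule measurable_PiM_single') (auto intro: coord)
  then have [measurable]: "(\<lambda>x. x) \<in> path_space d \<Omega> \<rightarrow>\<^sub>M borel"
    using measurable_cong_sets[OF refl sets_PiM_equal_borel] by blast
  have "(f \<circ> e) \<circ> (\<lambda>x. x) \<in> borel_measurable (path_space d \<Omega>)"
    by measurable
  moreover have "((f \<circ> e) \<circ> (\<lambda>x. x)) x = f x" if "x \<in> space (path_space d \<Omega>)" for x
    using that by (auto simp: path_space_def space_PiM e_def)
  ultimately show ?thesis
    by (simp cong: measurable_cong)
qed

locale box =
  fixes d :: nat and \<Omega> :: "nat \<Rightarrow> real set" and l u :: "nat \<Rightarrow> real"
  assumes box_eq: "i \<in> {1..d} \<Longrightarrow> \<Omega> i = {l i..u i}"
    and box_nonempty: "i \<in> {1..d} \<Longrightarrow> l i \<le> u i"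
begin

abbreviation "laws \<equiv> space (prob_algebra (path_space d \<Omega>))"
abbreviation "martingales \<equiv> martingale_measures d \<Omega>"

lemma space_path: "space (path_space d \<Omega>) = PiE {1..d} \<Omega>"
  by (auto simp: path_space_def space_PiM space_restrict_space intro!: PiE_cong)

lemma lawsD:
  assumes "\<pi> \<in> laws"
  shows "prob_space \<pi>" "sets \<pi> = sets (path_space d \<Omega>)" "space \<pi> = PiE {1..d} \<Omega>"
  using assms sets_eq_imp_space_eq[of \<pi> "path_space d \<Omega>"] by (auto simp: space_prob_algebra space_path)

lemma measurable_path:
  assumes "\<pi> \<in> laws"
  shows "f \<in> \<pi> \<rightarrow>\<^sub>M N \<longleftrightarrow> f \<in> path_space d \<Omega> \<rightarrow>\<^sub>M N"
  by (rule arg_cong[where f="\<lambda>S. f \<in> S"] measurable_cong_sets)+ (simp_all add: lawsD(2)[OF assms])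

lemma path_continuous_bounded:
  assumes "path_continuous d f"
  obtains C where "\<And>x. x \<in> space (path_space d \<Omega>) \<Longrightarrow> \<bar>f x\<bar> \<le> C"
proof -
  have "compactin (product_topology (\<lambda>_. euclideanreal) {1..d}) (PiE {1..d} \<Omega>)"
    unfolding compactin_PiE by (auto simp: box_eq)
  then have "compactin euclideanreal (f ` PiE {1..d} \<Omega>)"
    using assms by (rule image_compactin)
  then have "bounded (f ` PiE {1..d} \<Omega>)"
    by (simp add: compact_imp_bounded)
  then show thesis
    using that unfolding bounded_iff space_path by auto
qed

lemma integrable_path_continuous:
  assumes "\<pi> \<in> laws" "path_continuous d f"
  shows "integrable \<pi> f"
proof -
  interpret prob_space \<pi> using lawsD[OF assms(1)] by simp
  obtain C where "\<And>x. x \<in> space (path_space d \<Omega>) \<Longrightarrow> \<bar>f x\<bar> \<le> C"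
    using path_continuous_bounded[OF assms(2)] by blast
  then show ?thesis
    using borel_measurable_path_continuous[OF assms(2), of \<Omega>] lawsD[OF assms(1)]
    by (intro integrable_const_bound[where B=C] AE_I2) (auto simp: measurable_path[OF assms(1)] space_path)
qed

lemma path_continuous_expectation_bounded:
  assumes "path_continuous d f"
  obtains C where "0 \<le> C" "\<And>\<pi>. \<pi> \<in> laws \<Longrightarrow> \<bar>\<integral>w. f w \<partial>\<pi>\<bar> \<le> C"
proof -
  obtain C where C: "\<And>w. w \<in> space (path_space d \<Omega>) \<Longrightarrow> \<bar>f w\<bar> \<le> C"
    using path_continuous_bounded[OF assms] by blast
  have "\<bar>\<integral>w. f w \<partial>\<pi>\<bar> \<le> \<bar>C\<bar>" if law: "\<pi> \<in> laws" for \<pi>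
  proof -
    interpret prob_space \<pi> by (rule lawsD(1)[OF law])
    have "\<bar>\<integral>w. f w \<partial>\<pi>\<bar> \<le> (\<integral>w. \<bar>f w\<bar> \<partial>\<pi>)"
      by (rule integral_abs_bound)
    also have "\<dots> \<le> \<bar>C\<bar>"
      using C by (intro integral_le_const integrable_abs integrable_path_continuous law assms AE_I2)
        (force simp: lawsD(3)[OF law] space_path)
    finally show ?thesis .
  qed
  then show thesis using that[of "\<bar>C\<bar>"] by simp
qed

end

section \<open>Mixtures of laws\<close>

text \<open>
  Tossing a coin first and then sampling makes the convex combination an instance of the monadic
  bind, which supplies its integrals and its images.
\<close>

definition mixture :: "real \<Rightarrow> 'a measure \<Rightarrow> 'a measure \<Rightarrow> 'a measure" where
  "mixture t \<mu> \<nu> = measure_pmf (bernoulli_pmf t) \<bind> (\<lambda>b. if b then \<mu> else \<nu>)"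

context
  fixes M \<mu> \<nu> and t :: real
  assumes \<mu>: "\<mu> \<in> space (prob_algebra M)" and \<nu>: "\<nu> \<in> space (prob_algebra M)"
    and t: "0 \<le> t" "t \<le> 1"
begin

lemma mixture_kernel: "(\<lambda>b. if b then \<mu> else \<nu>) \<in> measure_pmf (bernoulli_pmf t) \<rightarrow>\<^sub>M prob_algebra M"
  using \<mu> \<nu> by simp

lemma mixture_in_prob_algebra: "mixture t \<mu> \<nu> \<in> space (prob_algebra M)"
proof -
  have "(\<lambda>_::unit. measure_pmf (bernoulli_pmf t) \<bind> (\<lambda>b. if b then \<mu> else \<nu>)) \<in> count_space UNIV \<rightarrow>\<^sub>M prob_algebra M"
    by (rule measurable_bind_prob_space[OF _ mixture_kernel])
       (simp add: space_prob_algebra prob_space_measure_pmf)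
  then show ?thesis
    unfolding mixture_def by (rule measurable_space) simp
qed

lemma nn_integral_mixture:
  assumes "f \<in> borel_measurable M"
  shows "(\<integral>\<^sup>+x. f x \<partial>mixture t \<mu> \<nu>) = ennreal t * (\<integral>\<^sup>+x. f x \<partial>\<mu>) + ennreal (1 - t) * (\<integral>\<^sup>+x. f x \<partial>\<nu>)"
  unfolding mixture_def nn_integral_bind[OF assms measurable_prob_algebraD[OF mixture_kernel]]
  using t by (simp add: mult.commute)

lemma integral_mixture:
  fixes f :: "_ \<Rightarrow> real"
  assumes f: "f \<in> borel_measurable M" and C: "\<And>x. x \<in> space M \<Longrightarrow> \<bar>f x\<bar> \<le> C"
  shows "(\<integral>x. f x \<partial>mixture t \<mu> \<nu>) = t * (\<integral>x. f x \<partial>\<mu>) + (1 - t) * (\<integral>x. f x \<partial>\<nu>)"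
proof -
  have "(\<integral>x. f x \<partial>mixture t \<mu> \<nu>) = (\<integral>b. (\<integral>x. f x \<partial>(if b then \<mu> else \<nu>)) \<partial>measure_pmf (bernoulli_pmf t))"
    unfolding mixture_def
    using \<mu> \<nu>
    by (intro integral_bind[where B'=1, OF f C measurable_prob_algebraD[OF mixture_kernel]])
       (auto simp: space_prob_algebra prob_space.emeasure_space_1 measure_pmf.finite_measure_axioms)
  then show ?thesis
    using t by (simp add: mult.commute)
qed

lemma distr_mixture:
  assumes g: "g \<in> M \<rightarrow>\<^sub>M N"
  shows "distr (mixture t \<mu> \<nu>) N g = mixture t (distr \<mu> N g) (distr \<nu> N g)"
proof -
  have "distr (mixture t \<mu> \<nu>) N g
    = measure_pmf (bernoulli_pmf t) \<bind> (\<lambda>b. distr (if b then \<mu> else \<nu>) N g)"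
    unfolding mixture_def
    by (rule distr_bind[OF measurable_prob_algebraD[OF mixture_kernel] _ g]) simp
  also have "(\<lambda>b. distr (if b then \<mu> else \<nu>) N g) = (\<lambda>b. if b then distr \<mu> N g else distr \<nu> N g)"
    by auto
  finally show ?thesis
    unfolding mixture_def .
qed

end

section \<open>Martingales tested by continuous functions\<close>

lemma space_coord_sigma: "space (coord_sigma \<pi> k) = space \<pi>"
  unfolding coord_sigma_def by (rule space_measure_of) auto

lemma sets_coord_sigma:
  "sets (coord_sigma \<pi> k) =
     sigma_sets (space \<pi>) (\<Union>i\<in>{1..k}. {(\<lambda>x. x i) -` A \<inter> space \<pi> | A. A \<in> sets borel})"
  unfolding coord_sigma_def by (rule sets_measure_of) auto

lemma measurable_coord_sigma: "i \<in> {1..k} \<Longrightarrow> (\<lambda>x. x i) \<in> borel_measurable (coord_sigma \<pi> k)"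
proof (rule measurableI)
  fix A :: "real set" assume i: "i \<in> {1..k}" and A: "A \<in> sets borel"
  have "(\<lambda>x. x i) -` A \<inter> space \<pi> \<in> {(\<lambda>x. x i) -` A \<inter> space \<pi> | A. A \<in> sets borel}"
    using A by blast
  then show "(\<lambda>x. x i) -` A \<inter> space (coord_sigma \<pi> k) \<in> sets (coord_sigma \<pi> k)"
    unfolding space_coord_sigma sets_coord_sigma by (intro sigma_sets.Basic UN_I[OF i])
qed simp

lemma measurable_coord: "i \<in> {1..d} \<Longrightarrow> (\<lambda>x. x i) \<in> borel_measurable (path_space d \<Omega>)"
  by (intro borel_measurable_path_continuous path_continuous_coord_id)

text \<open>
  The lower orthants are stable under intersection and their indicators are limits of products of
  continuous functions of single coordinates, which makes them the right generator for passing from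
  continuous test functions to events.
\<close>

lemma sets_coord_sigma_orthants:
  assumes "1 \<le> k"
  shows "sets (coord_sigma \<pi> k) = sigma_sets (space \<pi>) (range (\<lambda>q::nat \<Rightarrow> real. {x \<in> space \<pi>. \<forall>i\<in>{1..k}. x i \<le> q i}))"
    (is "_ = sigma_sets _ ?G")
proof
  define F where "F = sigma (space \<pi>) ?G"
  have F: "space F = space \<pi>" "sets F = sigma_sets (space \<pi>) ?G"
    unfolding F_def by (auto intro!: space_measure_of sets_measure_of)
  have meas: "(\<lambda>x. x i) \<in> borel_measurable F" if i: "i \<in> {1..k}" for i
    unfolding borel_measurable_iff_le
  proof safe
    fix a :: real
    have "{x \<in> space F. x i \<le> a} = (\<Union>n::nat. {x \<in> space \<pi>. \<forall>j\<in>{1..k}. x j \<le> (if j = i then a else real n)})"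
      (is "?L = ?R")
    proof
      show "?L \<subseteq> ?R"
      proof
        fix x assume x: "x \<in> ?L"
        obtain n :: nat where n: "Max ((\<lambda>j. x j) ` {1..k}) \<le> n"
          using real_arch_simple by blast
        have "x j \<le> n" if "j \<in> {1..k}" for j
          using that by (intro order_trans[OF _ n] Max_ge) auto
        then have "x \<in> {x \<in> space \<pi>. \<forall>j\<in>{1..k}. x j \<le> (if j = i then a else real n)}"
          using x by (simp add: F)
        then show "x \<in> ?R"
          by (rule UN_I[OF UNIV_I])
      qed
      show "?R \<subseteq> ?L"
      proof
        fix x assume "x \<in> ?R"
        then obtain n :: nat where x: "x \<in> space \<pi>" "\<forall>j\<in>{1..k}. x j \<le> (if j = i then a else real n)"
          by blast
        then show "x \<in> ?L"
          using bspec[OF x(2) i] by (simp add: F)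
      qed
    qed
    also have "\<dots> \<in> sets F"
      unfolding F(2) by (intro sigma_sets.Union sigma_sets.Basic) auto
    finally show "{x \<in> space F. x i \<le> a} \<in> sets F" .
  qed
  show "sets (coord_sigma \<pi> k) \<subseteq> sigma_sets (space \<pi>) ?G"
  proof -
    have "(\<lambda>x. x i) -` A \<inter> space \<pi> \<in> sets F" if "i \<in> {1..k}" "A \<in> sets borel" for i A
      using measurable_sets[OF meas[OF that(1)] that(2)] by (simp add: F)
    then have "sigma_sets (space F) (\<Union>i\<in>{1..k}. {(\<lambda>x. x i) -` A \<inter> space \<pi> | A. A \<in> sets borel}) \<subseteq> sets F"
      by (intro sets.sigma_sets_subset) auto
    then show ?thesis
      unfolding sets_coord_sigma by (simp only: F)
  qed
  have "{x \<in> space \<pi>. \<forall>i\<in>{1..k}. x i \<le> q i} \<in> sets (coord_sigma \<pi> k)" for q :: "nat \<Rightarrow> real"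
  proof -
    have "{x \<in> space (coord_sigma \<pi> k). x i \<le> q i} \<in> sets (coord_sigma \<pi> k)" if "i \<in> {1..k}" for i
      using measurable_coord_sigma[OF that, of \<pi>] unfolding borel_measurable_iff_le by blast
    then have "{x \<in> space (coord_sigma \<pi> k). \<forall>i\<in>{1..k}. x i \<le> q i} \<in> sets (coord_sigma \<pi> k)"
      by (intro sets.sets_Collect_finite_All) auto
    then show ?thesis
      by (simp add: space_coord_sigma)
  qed
  then have "?G \<subseteq> sets (coord_sigma \<pi> k)"
    by blast
  then show "sigma_sets (space \<pi>) ?G \<subseteq> sets (coord_sigma \<pi> k)"
    using sets.sigma_sets_subset[of ?G "coord_sigma \<pi> k"] by (simp only: space_coord_sigma)
qed

text \<open>Continuous approximations of the indicator of {..q}.\<close>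

definition ramp :: "nat \<Rightarrow> real \<Rightarrow> real \<Rightarrow> real" where
  "ramp n q x = max 0 (min 1 (1 - real n * (x - q)))"

lemma ramp_bounds: "0 \<le> ramp n q x" "ramp n q x \<le> 1"
  by (auto simp: ramp_def)

lemma continuous_ramp: "continuous_on UNIV (ramp n q)"
  unfolding ramp_def by (intro continuous_intros)

lemma ramp_tendsto: "(\<lambda>n. ramp n q x) \<longlonglongrightarrow> of_bool (x \<le> q)"
proof (cases "x \<le> q")
  case True
  then have "ramp n q x = 1" for n
    unfolding ramp_def using mult_nonneg_nonpos[of "real n" "x - q"] by auto
  then show ?thesis using True by simp
next
  case False
  obtain N :: nat where N: "1 / (x - q) \<le> N"
    using real_arch_simple by blast
  have "ramp n q x = 0" if "n \<ge> N" for n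
  proof -
    have "1 / (x - q) \<le> n"
      using N that by (meson of_nat_le_iff order_trans)
    then have "1 \<le> n * (x - q)"
      using False by (simp add: field_simps)
    then show ?thesis by (simp add: ramp_def)
  qed
  then have "eventually (\<lambda>n. ramp n q x = 0) sequentially"
    by (auto simp: eventually_sequentially)
  then show ?thesis
    using False by (simp add: tendsto_eventually)
qed

lemma path_continuous_test:
  assumes "k \<in> {1..<d}" "\<And>i. continuous_on UNIV (\<phi> i)"
  shows "path_continuous d (\<lambda>x. (x (Suc k) - x k) * (\<Prod>i\<in>{1..k}. \<phi> i (x i)))"
proof -
  have "path_continuous d (\<lambda>x. x (Suc k))" "path_continuous d (\<lambda>x. x k)"
    using assms(1) by (auto intro!: path_continuous_coord_id simp del: One_nat_def)
  moreover have "path_continuous d (\<lambda>x. \<phi> i (x i))" if "i \<in> {1..k}" for i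
    using assms that by (intro path_continuous_coord) auto
  ultimately show ?thesis
    by (intro continuous_map_real_mult continuous_map_diff continuous_map_prod) auto
qed

context box
begin

lemma subalgebra_coord_sigma:
  assumes "\<pi> \<in> laws" "k \<le> d"
  shows "subalgebra \<pi> (coord_sigma \<pi> k)"
proof -
  have "(\<lambda>x. x i) -` A \<inter> space \<pi> \<in> sets \<pi>" if "i \<in> {1..k}" "A \<in> sets borel" for i A
    using measurable_coord[of i] assms that
    by (intro measurable_sets) (auto simp: measurable_path)
  then show ?thesis
    unfolding subalgebra_def space_coord_sigma sets_coord_sigma
    by (auto intro!: sets.sigma_sets_subset)
qed

text \<open>
  Conditional expectations do not pass to weak limits, mixtures or images, but integrals of
  continuous functions do. One direction pulls the test function out of the conditional expectation.
  For the other, ramps approximate the indicators of orthants, and Dynkin's lemma extends the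
  vanishing integral from orthants to all events of the past.
\<close>

proposition martingales_iff:
  "\<pi> \<in> martingales \<longleftrightarrow> \<pi> \<in> laws \<and>
     (\<forall>k\<in>{1..<d}. \<forall>\<phi>. (\<forall>i. continuous_on UNIV (\<phi> i)) \<longrightarrow>
        (\<integral>x. (x (Suc k) - x k) * (\<Prod>i\<in>{1..k}. \<phi> i (x i)) \<partial>\<pi>) = 0)"
proof (intro iffI conjI ballI allI impI)
  assume "\<pi> \<in> martingales"
  then show law: "\<pi> \<in> laws"
    by (simp add: martingale_measures_def)
  fix k and \<phi> :: "nat \<Rightarrow> real \<Rightarrow> real" assume k: "k \<in> {1..<d}" and \<phi>: "\<forall>i. continuous_on UNIV (\<phi> i)"
  interpret prob_space \<pi> using lawsD[OF law] by simp
  define F where "F = coord_sigma \<pi> k"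
  interpret finite_measure_subalgebra \<pi> F
    by standard (use law k in \<open>simp add: F_def subalgebra_coord_sigma\<close>)
  have ae: "AE x in \<pi>. real_cond_exp \<pi> F (\<lambda>y. y (Suc k)) x = x k"
    using \<open>\<pi> \<in> martingales\<close> k by (auto simp: martingale_measures_def F_def)
  define h where "h x = (\<Prod>i\<in>{1..k}. \<phi> i (x i))" for x
  have \<phi>m: "(\<lambda>x. \<phi> i (x i)) \<in> borel_measurable F" if "i \<in> {1..k}" for i
    unfolding F_def using \<phi>
    by (intro measurable_compose[OF measurable_coord_sigma[OF that] borel_measurable_continuous_onI]) simp
  have hF: "h \<in> borel_measurable F"
    unfolding h_def by (intro borel_measurable_prod \<phi>m)
  have "path_continuous d h"
    unfolding h_def using \<phi> k by (intro continuous_map_prod path_continuous_coord) auto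
  then have c: "path_continuous d (\<lambda>x. h x * x (Suc k))" "path_continuous d (\<lambda>x. h x * x k)"
    using k by (auto intro!: continuous_map_real_mult path_continuous_coord_id simp del: One_nat_def)
  have "(\<integral>x. h x * x (Suc k) \<partial>\<pi>) = (\<integral>x. h x * real_cond_exp \<pi> F (\<lambda>y. y (Suc k)) x \<partial>\<pi>)"
    using k hF
    by (intro real_cond_exp_intg(2)[symmetric] integrable_path_continuous[OF law c(1)])
       (auto simp: measurable_path[OF law] measurable_coord)
  also have "\<dots> = (\<integral>x. h x * x k \<partial>\<pi>)"
  proof (rule integral_cong_AE)
    show "(\<lambda>x. h x * real_cond_exp \<pi> F (\<lambda>y. y (Suc k)) x) \<in> borel_measurable \<pi>"
      using measurable_from_subalg[OF subalg hF] by measurable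
    show "(\<lambda>x. h x * x k) \<in> borel_measurable \<pi>"
      using integrable_path_continuous[OF law c(2)] by auto
  qed (use ae in auto)
  finally have "(\<integral>x. h x * x (Suc k) - h x * x k \<partial>\<pi>) = 0"
    using integrable_path_continuous[OF law c(1)] integrable_path_continuous[OF law c(2)]
    by simp
  then show "(\<integral>x. (x (Suc k) - x k) * (\<Prod>i\<in>{1..k}. \<phi> i (x i)) \<partial>\<pi>) = 0"
    by (simp add: h_def algebra_simps)
next
  assume *: "\<pi> \<in> laws \<and>
     (\<forall>k\<in>{1..<d}. \<forall>\<phi>. (\<forall>i. continuous_on UNIV (\<phi> i)) \<longrightarrow>
        (\<integral>x. (x (Suc k) - x k) * (\<Prod>i\<in>{1..k}. \<phi> i (x i)) \<partial>\<pi>) = 0)"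
  then have law: "\<pi> \<in> laws" by blast
  have weak: "(\<integral>x. (x (Suc k) - x k) * (\<Prod>i\<in>{1..k}. \<phi> i (x i)) \<partial>\<pi>) = 0"
    if "k \<in> {1..<d}" "\<And>i. continuous_on UNIV (\<phi> i)" for k and \<phi> :: "nat \<Rightarrow> real \<Rightarrow> real"
    using * that by blast
  interpret prob_space \<pi> using lawsD[OF law] by simp
  have "AE x in \<pi>. real_cond_exp \<pi> (coord_sigma \<pi> k) (\<lambda>y. y (Suc k)) x = x k" if k: "k \<in> {1..<d}" for k
  proof -
    define F where "F = coord_sigma \<pi> k"
    interpret finite_measure_subalgebra \<pi> F
      by standard (use law k in \<open>simp add: F_def subalgebra_coord_sigma\<close>)
    define D where "D x = x (Suc k) - x k" for x :: "nat \<Rightarrow> real"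
    have "path_continuous d D"
      unfolding D_def using k by (intro continuous_map_diff path_continuous_coord_id) auto
    then have D: "integrable \<pi> D"
      by (rule integrable_path_continuous[OF law])
    have ints: "integrable \<pi> (\<lambda>x. x (Suc k))" "integrable \<pi> (\<lambda>x. x k)"
      using k by (auto intro!: integrable_path_continuous[OF law] path_continuous_coord_id simp del: One_nat_def)
    define G where "G = range (\<lambda>q::nat \<Rightarrow> real. {x \<in> space \<pi>. \<forall>i\<in>{1..k}. x i \<le> q i})"
    have Fset: "A \<in> sets \<pi>" if "A \<in> sets F" for A
      using that subalg by (auto simp: subalgebra_def)
    have FG: "sets F = sigma_sets (space \<pi>) G"
      unfolding F_def G_def using k by (intro sets_coord_sigma_orthants) auto
    \<comment> \<open>products of ramps decrease to indicators of orthants\<close>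
    have orthant: "(\<integral>x. indicator {x \<in> space \<pi>. \<forall>i\<in>{1..k}. x i \<le> q i} x * D x \<partial>\<pi>) = 0" for q :: "nat \<Rightarrow> real"
    proof -
      define S where "S = {x \<in> space \<pi>. \<forall>i\<in>{1..k}. x i \<le> q i}"
      have S: "S \<in> sets \<pi>"
        by (rule Fset) (auto simp: FG G_def S_def intro!: sigma_sets.Basic)
      have "(\<lambda>n. \<integral>x. D x * (\<Prod>i\<in>{1..k}. ramp n (q i) (x i)) \<partial>\<pi>) \<longlonglongrightarrow> (\<integral>x. indicator S x * D x \<partial>\<pi>)"
      proof (rule integral_dominated_convergence[where w="\<lambda>x. \<bar>D x\<bar>"])
        show "(\<lambda>x. indicator S x * D x) \<in> borel_measurable \<pi>" "integrable \<pi> (\<lambda>x. \<bar>D x\<bar>)"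
          using S D by auto
        show "(\<lambda>x. D x * (\<Prod>i\<in>{1..k}. ramp n (q i) (x i))) \<in> borel_measurable \<pi>" for n
          unfolding D_def measurable_path[OF law]
          by (intro borel_measurable_path_continuous path_continuous_test k continuous_ramp)
        have "(\<lambda>n. D x * (\<Prod>i\<in>{1..k}. ramp n (q i) (x i))) \<longlonglongrightarrow> indicator S x * D x" if "x \<in> space \<pi>" for x
        proof -
          have "(\<lambda>n. D x * (\<Prod>i\<in>{1..k}. ramp n (q i) (x i))) \<longlonglongrightarrow> D x * (\<Prod>i\<in>{1..k}. of_bool (x i \<le> q i))"
            by (intro tendsto_intros ramp_tendsto)
          also have "(\<Prod>i\<in>{1..k}. of_bool (x i \<le> q i)) = (indicator S x :: real)"
            using that by (auto simp: S_def indicator_def)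
          finally show ?thesis by (simp add: mult.commute)
        qed
        then show "AE x in \<pi>. (\<lambda>n. D x * (\<Prod>i\<in>{1..k}. ramp n (q i) (x i))) \<longlonglongrightarrow> indicator S x * D x"
          by auto
        show "AE x in \<pi>. norm (D x * (\<Prod>i\<in>{1..k}. ramp n (q i) (x i))) \<le> \<bar>D x\<bar>" for n
        proof (rule AE_I2)
          fix x
          have "\<bar>\<Prod>i\<in>{1..k}. ramp n (q i) (x i)\<bar> \<le> 1"
            unfolding abs_prod by (rule prod_le_1) (simp add: ramp_bounds abs_le_iff order_trans[OF _ ramp_bounds(1)])
          then show "norm (D x * (\<Prod>i\<in>{1..k}. ramp n (q i) (x i))) \<le> \<bar>D x\<bar>"
            by (simp add: abs_mult mult_left_le)
        qed
      qed
      moreover have "(\<integral>x. D x * (\<Prod>i\<in>{1..k}. ramp n (q i) (x i)) \<partial>\<pi>) = 0" for n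
        unfolding D_def by (rule weak[OF k]) (rule continuous_ramp)
      ultimately show ?thesis
        unfolding S_def by (simp add: LIMSEQ_const_iff)
    qed
    have total: "(\<integral>x. D x \<partial>\<pi>) = 0"
      using weak[OF k, of "\<lambda>i x. 1"] unfolding D_def by simp
    have main: "(\<integral>x\<in>A. D x \<partial>\<pi>) = 0" if "A \<in> sets F" for A
    proof -
      have "A \<in> sigma_sets (space \<pi>) G" using that FG by simp
      have stable: "Int_stable G"
      proof (rule Int_stableI)
        fix A B assume "A \<in> G" "B \<in> G"
        then obtain p q where "A = {x \<in> space \<pi>. \<forall>i\<in>{1..k}. x i \<le> p i}" "B = {x \<in> space \<pi>. \<forall>i\<in>{1..k}. x i \<le> q i}"
          unfolding G_def by blast
        then have "A \<inter> B = {x \<in> space \<pi>. \<forall>i\<in>{1..k}. x i \<le> min (p i) (q i)}" by auto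
        then show "A \<inter> B \<in> G" unfolding G_def by (rule image_eqI[where x="\<lambda>i. min (p i) (q i)"]) simp
      qed
      have Gpow: "G \<subseteq> Pow (space \<pi>)" by (auto simp: G_def)
      from stable Gpow \<open>A \<in> sigma_sets (space \<pi>) G\<close> show ?thesis
      proof (induct rule: sigma_sets_induct_disjoint)
        case (basic A)
        then show ?case
          using orthant by (auto simp: G_def set_lebesgue_integral_def)
      next
        case empty
        then show ?case by (simp add: set_lebesgue_integral_def)
      next
        case (compl A)
        have A: "A \<in> sets \<pi>" using compl(1) FG Fset by simp
        have "(\<integral>x\<in>space \<pi> - A. D x \<partial>\<pi>) = (\<integral>x. D x - indicator A x * D x \<partial>\<pi>)"
          unfolding set_lebesgue_integral_def
          by (intro Bochner_Integration.integral_cong) (auto simp: indicator_def)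
        also have "\<dots> = 0"
          using A D compl(2) total integrable_mult_indicator[OF A D]
          by (simp add: set_lebesgue_integral_def)
        finally show ?case .
      next
        case (union A)
        have A: "A i \<in> sets \<pi>" for i using union(2) FG Fset by auto
        have "set_integrable \<pi> (\<Union>i. A i) D"
          unfolding set_integrable_def by (rule integrable_mult_indicator[OF _ D]) (use A in auto)
        then have "(\<integral>x\<in>(\<Union>i. A i). D x \<partial>\<pi>) = (\<Sum>i. (\<integral>x\<in>A i. D x \<partial>\<pi>))"
          using union(1) A by (intro lebesgue_integral_countable_add) (auto simp: disjoint_family_on_def)
        then show ?case using union(3) by simp
      qed
    qed
    have "AE x in \<pi>. real_cond_exp \<pi> F (\<lambda>y. y (Suc k)) x = x k"
    proof (rule real_cond_exp_charact[OF _ ints])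
      show "(\<lambda>x. x k) \<in> borel_measurable F"
        unfolding F_def using k by (intro measurable_coord_sigma) auto
      fix A assume "A \<in> sets F"
      note A = Fset[OF this]
      have "(\<integral>x\<in>A. x (Suc k) \<partial>\<pi>) - (\<integral>x\<in>A. x k \<partial>\<pi>) = (\<integral>x\<in>A. D x \<partial>\<pi>)"
        unfolding D_def
        by (rule set_integral_diff(2)[symmetric])
           (auto simp: set_integrable_def intro!: integrable_mult_indicator A ints simp del: real_scaleR_def)
      then show "(\<integral>x\<in>A. x (Suc k) \<partial>\<pi>) = (\<integral>x\<in>A. x k \<partial>\<pi>)"
        using main[OF \<open>A \<in> sets F\<close>] by simp
    qed
    then show ?thesis by (simp add: F_def)
  qed
  with law show "\<pi> \<in> martingales"
    unfolding martingale_measures_def by blast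
qed

end

section \<open>A space-filling curve with a Borel section\<close>

text \<open>
  Schoenberg's curve: wave has period 2, is 0 on [0, 1/3] and 1 on [2/3, 1]. Evaluated at 3^m t it
  therefore tells, for any t whose ternary digits are all 0 or 2, whether digit m, counted from 0,
  is 2 (wave_ternary).
  Coordinate i collects, as binary digits, the ternary digits with an index coding a pair (i, k).
\<close>

definition wave :: "real \<Rightarrow> real" where
  "wave t = max 0 (min 1 (1/2 - cos (pi * t)))"

definition schoenberg :: "nat \<Rightarrow> real \<Rightarrow> real" where
  "schoenberg i t = (\<Sum>k. wave (3 ^ prod_encode (i, k) * t) / 2 ^ Suc k)"

lemma wave_bounds: "0 \<le> wave t" "wave t \<le> 1"
  by (auto simp: wave_def)

lemma half_powers_sums: "(\<lambda>k. 1 / 2 ^ Suc k :: real) sums 1"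
  using power_half_series by (simp add: power_divide)

lemma continuous_schoenberg: "continuous_on UNIV (schoenberg i)"
proof -
  have "uniform_limit UNIV (\<lambda>n t. \<Sum>k<n. wave (3 ^ prod_encode (i, k) * t) / 2 ^ Suc k) (schoenberg i) sequentially"
    unfolding schoenberg_def
  proof (rule Weierstrass_m_test)
    show "norm (wave (3 ^ prod_encode (i, k) * t) / 2 ^ Suc k) \<le> 1 / 2 ^ Suc k" for k t
      by (auto simp: wave_bounds divide_simps abs_le_iff order_trans[OF _ wave_bounds(1)])
  qed (rule sums_summable[OF half_powers_sums])
  then show ?thesis
    by (rule uniform_limit_theorem[rotated])
       (auto simp: wave_def intro!: always_eventually continuous_intros)
qed

lemma wave_periodic: "wave (t + 2 * of_int m) = wave t"
  unfolding wave_def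
  using cos_int_2pin[of m] sin_int_2pin[of m] by (simp add: algebra_simps cos_add)

lemma wave_eq_0: assumes "0 \<le> t" "t \<le> 1/3" shows "wave t = 0"
proof -
  have "cos (pi / 3) \<le> cos (pi * t)"
    using assms by (intro cos_monotone_0_pi_le) (auto simp: field_simps)
  then show ?thesis by (simp add: wave_def cos_60)
qed

lemma wave_eq_1: assumes "2/3 \<le> t" "t \<le> 1" shows "wave t = 1"
proof -
  have "cos (pi * t) \<le> cos (2 * (pi / 3))"
    using assms by (intro cos_monotone_0_pi_le) (auto simp: field_simps)
  also have "\<dots> = - 1 / 2"
    using cos_double_cos[of "pi / 3"] by (simp add: cos_60 power2_eq_square)
  finally show ?thesis by (simp add: wave_def)
qed

definition ternary :: "(nat \<Rightarrow> real) \<Rightarrow> real" where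
  "ternary a = (\<Sum>j. 2 * a j / 3 ^ Suc j)"

lemma third_powers_sums: "(\<lambda>j. 2 / 3 ^ Suc j :: real) sums 1"
  using sums_mult[OF geometric_sums[of "1/3::real"], of "2/3"] by (simp add: power_divide)

lemma ternary_summable:
  assumes "\<And>j. a j \<in> {0, 1}"
  shows "summable (\<lambda>j. 2 * a j / 3 ^ Suc j :: real)"
proof (rule summable_comparison_test'[OF sums_summable[OF third_powers_sums], where N=0])
  show "norm (2 * a n / 3 ^ Suc n) \<le> 2 / 3 ^ Suc n" for n
    using assms[of n] by auto
qed

lemma ternary_bounds:
  assumes "\<And>j. a j \<in> {0, 1}"
  shows "0 \<le> ternary a" "ternary a \<le> 1"
proof -
  have "0 \<le> a j" "a j \<le> 1" for j using assms[of j] by auto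
  then show "0 \<le> ternary a"
    unfolding ternary_def by (intro suminf_nonneg ternary_summable assms) auto
  have "ternary a \<le> (\<Sum>j. 2 / 3 ^ Suc j)"
    unfolding ternary_def using \<open>\<And>j. a j \<le> 1\<close>
    by (intro suminf_le ternary_summable assms sums_summable[OF third_powers_sums]) (auto simp: divide_simps)
  then show "ternary a \<le> 1"
    using third_powers_sums by (simp add: sums_iff)
qed

lemma ternary_Suc:
  assumes "\<And>j. a j \<in> {0, 1}"
  shows "3 * ternary a = 2 * a 0 + ternary (\<lambda>j. a (Suc j))"
proof -
  have "ternary a = (\<Sum>j. 2 * a (Suc j) / 3 ^ Suc (Suc j)) + 2 * a 0 / 3 ^ Suc 0"
    unfolding ternary_def using suminf_split_head[OF ternary_summable[of a, OF assms]] by linarith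
  also have "(\<Sum>j. 2 * a (Suc j) / 3 ^ Suc (Suc j)) = (\<Sum>j. 2 * a (Suc j) / 3 ^ Suc j / 3)"
    by (simp add: mult.commute mult.left_commute)
  also have "\<dots> = ternary (\<lambda>j. a (Suc j)) / 3"
    unfolding ternary_def
    by (rule suminf_divide) (intro ternary_summable assms)
  finally show ?thesis by simp
qed

text \<open>
  Multiplication by 3 shifts the expansion and adds the even integer 2 a_0, which the period of wave
  absorbs; for m = 0 the first digit decides in which third the number lies.
\<close>

lemma wave_ternary:
  assumes a: "\<And>j. a j \<in> {0, 1}"
  shows "wave (3 ^ m * ternary a) = a m"
  using a
proof (induction m arbitrary: a)
  case 0
  have "ternary a = (2 * a 0 + ternary (\<lambda>j. a (Suc j))) / 3"
    using ternary_Suc[of a] 0 by simp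
  then show ?case
    using ternary_bounds[of "\<lambda>j. a (Suc j)"] 0
    by (cases "a 0 = 0") (force intro!: wave_eq_0 wave_eq_1)+
next
  case (Suc m)
  \<comment> \<open>the shift by 2 * 3^m * a 0, written as an even integer\<close>
  define N :: int where "N = (if a 0 = 0 then 0 else 3 ^ m)"
  have "3 ^ Suc m * ternary a = 3 ^ m * (3 * ternary a)" by simp
  also have "\<dots> = 3 ^ m * ternary (\<lambda>j. a (Suc j)) + 2 * of_int N"
    using ternary_Suc[of a] Suc.prems[of 0] Suc.prems by (auto simp: N_def algebra_simps)
  finally show ?case
    using Suc.IH[of "\<lambda>j. a (Suc j)"] Suc.prems by (simp add: wave_periodic)
qed

definition binary_digit :: "real \<Rightarrow> nat \<Rightarrow> real" where
  "binary_digit x k = of_int (\<lfloor>2 ^ Suc k * x\<rfloor> - 2 * \<lfloor>2 ^ k * x\<rfloor>)"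

lemma binary_digit_bit: "binary_digit x k \<in> {0, 1}"
proof -
  have "\<lfloor>2 ^ Suc k * x\<rfloor> - 2 * \<lfloor>2 ^ k * x\<rfloor> \<in> {0, 1}"
    by (simp; linarith)
  then show ?thesis
    unfolding binary_digit_def by auto
qed

lemma binary_digits_sums:
  assumes "0 \<le> x" "x < 1"
  shows "(\<lambda>k. binary_digit x k / 2 ^ Suc k) sums x"
proof -
  \<comment> \<open>the partial sums telescope to the truncations of x after n binary digits\<close>
  define s :: "nat \<Rightarrow> real" where "s n = of_int \<lfloor>2 ^ n * x\<rfloor> / 2 ^ n" for n
  have "binary_digit x k / 2 ^ Suc k = s (Suc k) - s k" for k
    by (simp add: binary_digit_def s_def field_simps)
  moreover have "s \<longlonglongrightarrow> x"
  proof (rule tendsto_sandwich[of "\<lambda>n. x - 1 / 2 ^ n" _ _ "\<lambda>n. x"])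
    show "\<forall>\<^sub>F n in sequentially. x - 1 / 2 ^ n \<le> s n"
    proof (rule always_eventually, rule allI)
      fix n
      have "(2 ^ n * x - 1) / 2 ^ n \<le> s n"
        unfolding s_def by (rule divide_right_mono) (linarith, simp)
      then show "x - 1 / 2 ^ n \<le> s n" by (simp add: diff_divide_distrib)
    qed
    show "\<forall>\<^sub>F n in sequentially. s n \<le> x"
      by (rule always_eventually) (simp add: s_def field_simps)
    show "(\<lambda>n. x - 1 / 2 ^ n) \<longlonglongrightarrow> x"
      using tendsto_diff[OF tendsto_const LIMSEQ_divide_realpow_zero[of 2 1], of x] by simp
  qed simp
  ultimately have "(\<lambda>k. binary_digit x k / 2 ^ Suc k) sums (x - s 0)"
    using telescope_sums[of s x] by simp
  moreover have "\<lfloor>x\<rfloor> = 0" using assms by linarith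
  ultimately show ?thesis by (simp add: s_def)
qed

text \<open>
  The inverse of the curve: interleave the binary digits of all coordinates into one ternary
  expansion. It is Borel because every digit is.
\<close>

definition peano_code :: "(nat \<Rightarrow> real) \<Rightarrow> real" where
  "peano_code x = ternary (\<lambda>j. case prod_decode j of (i, k) \<Rightarrow> binary_digit (x i) k)"

lemma peano_code_bounds: "0 \<le> peano_code x" "peano_code x \<le> 1"
  unfolding peano_code_def
  by (rule ternary_bounds; simp split: prod.split add: binary_digit_bit[simplified])+

lemma schoenberg_peano_code:
  assumes "0 \<le> x i" "x i < 1"
  shows "schoenberg i (peano_code x) = x i"
proof -
  have "wave (3 ^ prod_encode (i, k) * peano_code x) = binary_digit (x i) k" for k
    unfolding peano_code_def
    by (subst wave_ternary) (auto split: prod.split simp: binary_digit_bit[simplified])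
  then show ?thesis
    using binary_digits_sums[OF assms] by (simp add: schoenberg_def sums_iff)
qed

lemma borel_measurable_peano_code:
  assumes "\<And>i. (\<lambda>w. X w i) \<in> borel_measurable M"
  shows "(\<lambda>w. peano_code (X w)) \<in> borel_measurable M"
proof -
  have "(\<lambda>w. case prod_decode j of (i, k) \<Rightarrow> binary_digit (X w i) k) \<in> borel_measurable M" for j
    using assms unfolding binary_digit_def by (cases "prod_decode j") (simp, measurable)
  then show ?thesis
    unfolding peano_code_def ternary_def by measurable
qed

section \<open>Sequential compactness\<close>

context box
begin

text \<open>
  Encode a path by a point of [0, 1] with the Borel section of the space-filling curve. The coded
  laws are tight, so Helly's theorem yields a weakly convergent subsequence on the line. The curve is
  continuous, so the limit decodes to a weak limit on the box. Only the decoding has to be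
  continuous. Rescaling into [0, 1) avoids the right end point, which has no binary expansion with the
  digits chosen here; clipping keeps the decoded points inside the box.
\<close>

proposition laws_sequentially_compact:
  fixes \<pi> :: "nat \<Rightarrow> (nat \<Rightarrow> real) measure"
  assumes laws: "\<And>n. \<pi> n \<in> laws"
  obtains r :: "nat \<Rightarrow> nat" and \<rho> where "strict_mono r" "\<rho> \<in> laws"
    "\<And>f. path_continuous d f \<Longrightarrow> (\<lambda>n. \<integral>x. f x \<partial>\<pi> (r n)) \<longlonglongrightarrow> (\<integral>x. f x \<partial>\<rho>)"
proof -
  define B where "B = (\<Sum>i\<in>{1..d}. \<bar>l i\<bar> + \<bar>u i\<bar>)"
  have B: "- B \<le> l i" "u i \<le> B" if "i \<in> {1..d}" for i
    using member_le_sum[OF that, of "\<lambda>i. \<bar>l i\<bar> + \<bar>u i\<bar>"] by (auto simp: B_def)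
  have "0 \<le> B" unfolding B_def by (intro sum_nonneg) auto
  \<comment> \<open>rescale coordinates from [-B, B] into [0, 1)\<close>
  define enc where "enc x = peano_code (\<lambda>i. if i \<in> {1..d} then (x i + B) / (2 * B + 1) else 0)" for x
  define dec where "dec t = (\<lambda>i\<in>{1..d}. max (l i) (min (u i) ((2 * B + 1) * schoenberg i t - B)))" for t
  have dec_enc: "dec (enc x) = x" if x: "x \<in> PiE {1..d} \<Omega>" for x
  proof
    fix i
    show "dec (enc x) i = x i"
    proof (cases "i \<in> {1..d}")
      case i: True
      have xi: "l i \<le> x i" "x i \<le> u i"
        using PiE_mem[OF x i] box_eq[OF i] by auto
      have "schoenberg i (enc x) = (x i + B) / (2 * B + 1)"
        unfolding enc_def using B[OF i] xi \<open>0 \<le> B\<close> i by (subst schoenberg_peano_code) auto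
      then show ?thesis
        using i xi \<open>0 \<le> B\<close> by (simp add: dec_def)
    next
      case False
      then show ?thesis
        using PiE_arb[OF x False] by (simp only: dec_def restrict_apply if_False)
    qed
  qed
  have enc_meas: "enc \<in> borel_measurable (path_space d \<Omega>)"
    unfolding enc_def
  proof (rule borel_measurable_peano_code)
    fix i show "(\<lambda>x. if i \<in> {1..d} then (x i + B) / (2 * B + 1) else 0) \<in> borel_measurable (path_space d \<Omega>)"
      using measurable_coord[of i] by (cases "i \<in> {1..d}") auto
  qed
  have comp_cont: "continuous_on UNIV (\<lambda>t. dec t i)" if "i \<in> {1..d}" for i
    using that unfolding dec_def by (simp add: continuous_schoenberg continuous_intros)
  have dec_in: "dec t i \<in> \<Omega> i" if "i \<in> {1..d}" for i t
    using box_eq[OF that] box_nonempty[OF that] that by (simp add: dec_def)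
  have dec_space: "dec t \<in> PiE {1..d} \<Omega>" for t
  proof (rule PiE_I)
    show "dec t i = undefined" if "i \<notin> {1..d}" for i
      using that by (simp only: dec_def restrict_apply if_False)
  qed (rule dec_in)
  have dec_meas: "dec \<in> borel \<rightarrow>\<^sub>M path_space d \<Omega>"
    unfolding path_space_def
  proof (rule measurable_PiM_single')
    show "(\<lambda>t. dec t i) \<in> borel \<rightarrow>\<^sub>M restrict_space borel (\<Omega> i)" if "i \<in> {1..d}" for i
      using dec_in[OF that] comp_cont[OF that]
      by (intro measurable_restrict_space2 borel_measurable_continuous_onI) auto
    show "dec \<in> space borel \<rightarrow> (\<Pi>\<^sub>E i\<in>{1..d}. space (restrict_space borel (\<Omega> i)))"
      using dec_space by (auto simp: space_restrict_space)
  qed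
  have dec_cont: "continuous_on UNIV (\<lambda>t. f (dec t))" if "path_continuous d f" for f
  proof -
    have "continuous_map euclideanreal (product_topology (\<lambda>_. euclideanreal) {1..d}) dec"
      unfolding continuous_map_componentwise using comp_cont by (auto simp: dec_def)
    from continuous_map_compose[OF this that] show ?thesis
      by (simp add: o_def)
  qed
  define \<mu> where "\<mu> n = distr (\<pi> n) borel enc" for n
  have real_distr: "real_distribution (\<mu> n)" for n
  proof -
    interpret prob_space "\<pi> n" by (rule lawsD(1)[OF laws])
    show ?thesis unfolding \<mu>_def
      using enc_meas by (intro real_distribution_distr) (simp add: measurable_path[OF laws])
  qed
  have "tight \<mu>"
    unfolding tight_def
  proof (intro conjI allI impI real_distr)
    fix \<epsilon> :: real assume "0 < \<epsilon>"
    have "measure (\<mu> n) {-1<..1} = 1" for n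
    proof -
      interpret prob_space "\<pi> n" by (rule lawsD(1)[OF laws])
      have "enc -` {-1<..1} \<inter> space (\<pi> n) = space (\<pi> n)"
        using order.strict_trans2[OF _ peano_code_bounds(1), of "-1"] peano_code_bounds(2) by (auto simp: enc_def)
      then show ?thesis
        using enc_meas by (simp add: \<mu>_def measure_distr measurable_path[OF laws] prob_space)
    qed
    then show "\<exists>a b. a < b \<and> (\<forall>n. 1 - \<epsilon> < measure (\<mu> n) {a<..b})"
      using \<open>0 < \<epsilon>\<close> by (intro exI[of _ "-1"] exI[of _ 1]) auto
  qed
  then obtain r M where r: "strict_mono (r :: nat \<Rightarrow> nat)" and M: "real_distribution M"
    and conv: "weak_conv_m (\<mu> \<circ> id \<circ> r) M"
    using tight_imp_convergent_subsubsequence[of \<mu> id] by (auto simp: strict_mono_id)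
  interpret M: real_distribution M by fact
  show thesis
  proof (rule that[OF r, of "distr M (path_space d \<Omega>) dec"])
    have M_dec: "dec \<in> M \<rightarrow>\<^sub>M path_space d \<Omega>"
      using dec_meas by simp
    then show "distr M (path_space d \<Omega>) dec \<in> laws"
      by (simp add: space_prob_algebra M.prob_space_distr)
    fix f assume f: "path_continuous d f"
    obtain C where C: "\<And>x. x \<in> space (path_space d \<Omega>) \<Longrightarrow> \<bar>f x\<bar> \<le> C"
      using path_continuous_bounded[OF f] by blast
    have "(\<lambda>n. \<integral>t. f (dec t) \<partial>(\<mu> \<circ> id \<circ> r) n) \<longlonglongrightarrow> (\<integral>t. f (dec t) \<partial>M)"
    proof (rule weak_conv_imp_integral_bdd_continuous_conv[OF _ M conv])
      show "isCont (\<lambda>t. f (dec t)) t" for t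
        using dec_cont[OF f] by (simp add: continuous_on_eq_continuous_within)
      show "norm (f (dec t)) \<le> C" for t
        using C dec_space by (simp add: space_path)
      show "real_distribution ((\<mu> \<circ> id \<circ> r) n)" for n
        using real_distr by simp
    qed
    moreover have "(\<integral>t. f (dec t) \<partial>(\<mu> \<circ> id \<circ> r) n) = (\<integral>x. f x \<partial>\<pi> (r n))" for n
    proof -
      have "(\<lambda>t. f (dec t)) \<in> borel_measurable borel"
        using dec_cont[OF f] by (rule borel_measurable_continuous_onI)
      then have "(\<integral>t. f (dec t) \<partial>(\<mu> \<circ> id \<circ> r) n) = (\<integral>x. f (dec (enc x)) \<partial>\<pi> (r n))"
        using enc_meas by (simp add: \<mu>_def integral_distr measurable_path[OF laws])
      also have "\<dots> = (\<integral>x. f x \<partial>\<pi> (r n))"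
        by (rule Bochner_Integration.integral_cong) (simp_all add: lawsD(3)[OF laws] dec_enc)
      finally show ?thesis .
    qed
    ultimately show "(\<lambda>n. \<integral>x. f x \<partial>\<pi> (r n)) \<longlonglongrightarrow> (\<integral>x. f x \<partial>distr M (path_space d \<Omega>) dec)"
      using integral_distr[OF M_dec borel_measurable_path_continuous[OF f]] by simp
  qed
qed

lemma path_continuous_hinge: "i \<in> {1..d} \<Longrightarrow> path_continuous d (\<lambda>w. \<bar>w i - q\<bar>)"
  by (rule path_continuous_coord) (auto intro!: continuous_intros)

lemma martingales_laws: "\<pi> \<in> martingales \<Longrightarrow> \<pi> \<in> laws"
  by (simp add: martingales_iff)

corollary martingales_sequentially_compact:
  fixes \<pi> :: "nat \<Rightarrow> (nat \<Rightarrow> real) measure"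
  assumes mart: "\<And>n. \<pi> n \<in> martingales"
  obtains r :: "nat \<Rightarrow> nat" and \<rho> where "strict_mono r" "\<rho> \<in> martingales"
    "\<And>f. path_continuous d f \<Longrightarrow> (\<lambda>n. \<integral>x. f x \<partial>\<pi> (r n)) \<longlonglongrightarrow> (\<integral>x. f x \<partial>\<rho>)"
proof -
  obtain r :: "nat \<Rightarrow> nat" and \<rho> where r: "strict_mono r" and \<rho>: "\<rho> \<in> laws"
    and lim: "\<And>f. path_continuous d f \<Longrightarrow> (\<lambda>n. \<integral>x. f x \<partial>\<pi> (r n)) \<longlonglongrightarrow> (\<integral>x. f x \<partial>\<rho>)"
    using laws_sequentially_compact[of \<pi>] martingales_laws[OF mart] by blast
  have "\<rho> \<in> martingales"
    unfolding martingales_iff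
  proof (intro conjI ballI allI impI \<rho>)
    fix k and \<phi> :: "nat \<Rightarrow> real \<Rightarrow> real"
    assume k: "k \<in> {1..<d}" and \<phi>: "\<forall>i. continuous_on UNIV (\<phi> i)"
    have "path_continuous d (\<lambda>x. (x (Suc k) - x k) * (\<Prod>i\<in>{1..k}. \<phi> i (x i)))"
      using k \<phi> by (intro path_continuous_test) auto
    moreover have "(\<integral>x. (x (Suc k) - x k) * (\<Prod>i\<in>{1..k}. \<phi> i (x i)) \<partial>\<pi> (r n)) = 0" for n
      using mart[of "r n"] k \<phi> unfolding martingales_iff by blast
    ultimately show "(\<integral>x. (x (Suc k) - x k) * (\<Prod>i\<in>{1..k}. \<phi> i (x i)) \<partial>\<rho>) = 0"
      using lim by (fastforce simp: LIMSEQ_const_iff)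
  qed
  then show thesis using that r lim by blast
qed

lemma integral_mixture_path:
  assumes "\<pi> \<in> laws" "\<rho> \<in> laws" "0 \<le> t" "t \<le> 1" "path_continuous d f"
  shows "(\<integral>x. f x \<partial>mixture t \<pi> \<rho>) = t * (\<integral>x. f x \<partial>\<pi>) + (1 - t) * (\<integral>x. f x \<partial>\<rho>)"
proof -
  obtain C where "\<And>x. x \<in> space (path_space d \<Omega>) \<Longrightarrow> \<bar>f x\<bar> \<le> C"
    using path_continuous_bounded[OF assms(5)] by blast
  then show ?thesis
    using integral_mixture[OF assms(1-4) borel_measurable_path_continuous[OF assms(5)]] by blast
qed

lemma mixture_martingales:
  assumes "\<pi> \<in> martingales" "\<rho> \<in> martingales" "0 \<le> t" "t \<le> 1"
  shows "mixture t \<pi> \<rho> \<in> martingales"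
  unfolding martingales_iff
proof (intro conjI ballI allI impI)
  note laws = martingales_laws[OF assms(1)] martingales_laws[OF assms(2)]
  show "mixture t \<pi> \<rho> \<in> laws"
    using laws assms(3,4) by (rule mixture_in_prob_algebra)
  fix k and \<phi> :: "nat \<Rightarrow> real \<Rightarrow> real"
  assume k: "k \<in> {1..<d}" and \<phi>: "\<forall>i. continuous_on UNIV (\<phi> i)"
  have c: "path_continuous d (\<lambda>x. (x (Suc k) - x k) * (\<Prod>i\<in>{1..k}. \<phi> i (x i)))"
    using k \<phi> by (intro path_continuous_test) auto
  have "(\<integral>x. (x (Suc k) - x k) * (\<Prod>i\<in>{1..k}. \<phi> i (x i)) \<partial>\<pi>) = 0"
       "(\<integral>x. (x (Suc k) - x k) * (\<Prod>i\<in>{1..k}. \<phi> i (x i)) \<partial>\<rho>) = 0"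
    using assms(1,2) k \<phi> unfolding martingales_iff by blast+
  then show "(\<integral>x. (x (Suc k) - x k) * (\<Prod>i\<in>{1..k}. \<phi> i (x i)) \<partial>mixture t \<pi> \<rho>) = 0"
    unfolding integral_mixture_path[OF laws assms(3,4) c] by simp
qed

end

section \<open>Hinges determine a law on the line\<close>

text \<open>
  Difference quotients of the hinge at q from the right tend to 1 on {..q} and to -1 to the
  right of q, boundedly, so they recover the distribution function.
\<close>

lemma (in prob_space) prob_le_from_hinges:
  fixes X :: "'a \<Rightarrow> real"
  assumes X: "integrable M X"
  shows "(\<lambda>n. (1 + real (Suc n) * ((\<integral>w. \<bar>X w - (q + 1 / real (Suc n))\<bar> \<partial>M) - (\<integral>w. \<bar>X w - q\<bar> \<partial>M))) / 2)
           \<longlonglongrightarrow> measure M {w \<in> space M. X w \<le> q}"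
proof -
  \<comment> \<open>the difference quotient, mapped affinely from [-1, 1] to [0, 1]\<close>
  define h where "h n x = (1 + real (Suc n) * (\<bar>x - (q + 1 / real (Suc n))\<bar> - \<bar>x - q\<bar>)) / 2" for n x
  have [measurable]: "X \<in> borel_measurable M" using X by auto
  have int: "integrable M (\<lambda>w. \<bar>X w - c\<bar>)" for c
    using X by simp
  have "(\<lambda>n. \<integral>w. h n (X w) \<partial>M) \<longlonglongrightarrow> (\<integral>w. indicator {w \<in> space M. X w \<le> q} w \<partial>M)"
  proof (rule integral_dominated_convergence[where w="\<lambda>_. 1"])
    show "AE w in M. (\<lambda>n. h n (X w)) \<longlonglongrightarrow> indicator {w \<in> space M. X w \<le> q} w"
    proof (rule AE_I2)
      fix w assume w: "w \<in> space M"
      show "(\<lambda>n. h n (X w)) \<longlonglongrightarrow> indicator {w \<in> space M. X w \<le> q} w"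
      proof (cases "X w \<le> q")
        case True
        have "h n (X w) = 1" for n
        proof -
          have "\<bar>X w - (q + 1 / real (Suc n))\<bar> = q + 1 / real (Suc n) - X w"
            using True by (intro abs_of_nonpos[THEN trans]) (auto intro: add_increasing2)
          moreover have "\<bar>X w - q\<bar> = q - X w" using True by simp
          ultimately show ?thesis by (simp add: h_def)
        qed
        then show ?thesis using True w by simp
      next
        case False
        have "(\<lambda>n. 1 / real (Suc n)) \<longlonglongrightarrow> 0"
          using LIMSEQ_inverse_real_of_nat by (simp add: inverse_eq_divide)
        then have "eventually (\<lambda>n. 1 / real (Suc n) < X w - q) sequentially"
          by (rule order_tendstoD(2)) (use False in simp)
        then have "eventually (\<lambda>n. h n (X w) = 0) sequentially"
        proof eventually_elim
          case (elim n)
          then have "\<bar>X w - (q + 1 / real (Suc n))\<bar> = X w - q - 1 / real (Suc n)" by simp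
          then show ?case using False by (simp add: h_def field_simps)
        qed
        then show ?thesis using False by (simp add: tendsto_eventually)
      qed
    qed
    show "AE w in M. norm (h n (X w)) \<le> 1" for n
    proof (rule AE_I2)
      fix w
      have "\<bar>\<bar>X w - (q + 1 / real (Suc n))\<bar> - \<bar>X w - q\<bar>\<bar> \<le> 1 / real (Suc n)"
        using abs_triangle_ineq3[of "X w - (q + 1 / real (Suc n))" "X w - q"] by simp
      then have "\<bar>real (Suc n) * (\<bar>X w - (q + 1 / real (Suc n))\<bar> - \<bar>X w - q\<bar>)\<bar> \<le> 1"
        using mult_left_mono[of _ "1 / real (Suc n)" "real (Suc n)"] by (simp only: abs_mult) simp
      moreover have half: "\<bar>y\<bar> \<le> 1 \<Longrightarrow> \<bar>(1 + y) / 2\<bar> \<le> 1" for y :: real by auto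
      ultimately show "norm (h n (X w)) \<le> 1"
        unfolding h_def real_norm_def by blast
    qed
  qed (auto simp: h_def)
  moreover have "(\<integral>w. h n (X w) \<partial>M) = (1 + real (Suc n) * ((\<integral>w. \<bar>X w - (q + 1 / real (Suc n))\<bar> \<partial>M) - (\<integral>w. \<bar>X w - q\<bar> \<partial>M))) / 2" for n
    unfolding h_def using int by (simp add: prob_space)
  ultimately show ?thesis by simp
qed

proposition distr_eq_if_hinges_eq:
  fixes X :: "'a \<Rightarrow> real" and Y :: "'b \<Rightarrow> real"
  assumes "prob_space M" "prob_space N" and X: "integrable M X" and Y: "integrable N Y"
    and eq: "\<And>q. (\<integral>w. \<bar>X w - q\<bar> \<partial>M) = (\<integral>w. \<bar>Y w - q\<bar> \<partial>N)"
  shows "distr M borel X = distr N borel Y"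
proof (rule cdf_unique)
  interpret M: prob_space M by fact
  interpret N: prob_space N by fact
  have [measurable]: "X \<in> borel_measurable M" "Y \<in> borel_measurable N" using X Y by auto
  show "real_distribution (distr M borel X)" "real_distribution (distr N borel Y)"
    by (auto intro: M.real_distribution_distr N.real_distribution_distr)
  show "cdf (distr M borel X) = cdf (distr N borel Y)"
  proof
    fix q
    have "measure M {w \<in> space M. X w \<le> q} = measure N {w \<in> space N. Y w \<le> q}"
      using M.prob_le_from_hinges[OF X, of q] N.prob_le_from_hinges[OF Y, of q]
      unfolding eq by (rule LIMSEQ_unique)
    then show "cdf (distr M borel X) q = cdf (distr N borel Y) q"
      by (simp add: cdf_def measure_distr vimage_def Int_def conj_commute)
  qed
qed

lemma integral_hinge_lipschitz:
  fixes X :: "'a \<Rightarrow> real"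
  assumes "prob_space M" "integrable M X"
  shows "\<bar>(\<integral>w. \<bar>X w - p\<bar> \<partial>M) - (\<integral>w. \<bar>X w - q\<bar> \<partial>M)\<bar> \<le> \<bar>p - q\<bar>"
proof -
  interpret prob_space M by fact
  have int: "integrable M (\<lambda>w. \<bar>X w - c\<bar>)" for c using assms(2) by simp
  have "\<bar>(\<integral>w. \<bar>X w - p\<bar> \<partial>M) - (\<integral>w. \<bar>X w - q\<bar> \<partial>M)\<bar> = \<bar>\<integral>w. \<bar>X w - p\<bar> - \<bar>X w - q\<bar> \<partial>M\<bar>"
    using int by simp
  also have "\<dots> \<le> (\<integral>w. \<bar>\<bar>X w - p\<bar> - \<bar>X w - q\<bar>\<bar> \<partial>M)"
    by (rule integral_abs_bound)
  also have "\<dots> \<le> \<bar>p - q\<bar>"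
    using int by (intro integral_le_const AE_I2) auto
  finally show ?thesis .
qed

lemma integrable_continuous_on_interval:
  fixes \<phi> :: "real \<Rightarrow> real"
  assumes "prob_space N" and meas: "(\<lambda>x. x) \<in> borel_measurable N" and space: "space N \<subseteq> {a..b}"
    and \<phi>: "continuous_on UNIV \<phi>"
  shows "integrable N \<phi>"
proof -
  interpret prob_space N by fact
  have "compact (\<phi> ` {a..b})"
    by (intro compact_continuous_image continuous_on_subset[OF \<phi>]) auto
  then obtain C where "\<forall>x\<in>{a..b}. norm (\<phi> x) \<le> C"
    using compact_imp_bounded[of "\<phi> ` {a..b}"] unfolding bounded_iff by blast
  then show ?thesis
    using space measurable_compose[OF meas borel_measurable_continuous_onI[OF \<phi>]]
    by (intro integrable_const_bound[where B=C] AE_I2) auto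
qed

section \<open>Dynamic programming over martingales\<close>

text \<open>
  On a cube the mean of a martingale, and any value of the last coordinate, is an admissible value
  of every coordinate. This is what allows initial segments to be frozen below.
\<close>

locale cube =
  fixes d :: nat and a b :: real
  assumes interval_nonempty: "a \<le> b" and horizon: "1 \<le> d"
begin

sublocale box d "\<lambda>_. {a..b}" "\<lambda>_. a" "\<lambda>_. b"
  by standard (auto simp: interval_nonempty)

abbreviation "P \<equiv> path_space d (\<lambda>_. {a..b})"

abbreviation mean :: "(nat \<Rightarrow> real) measure \<Rightarrow> real" where
  "mean \<pi> \<equiv> \<integral>w. w d \<partial>\<pi>"

lemma last_coord: "d \<in> {1..d}"
  using horizon by simp

lemma expectation_coord:
  assumes \<pi>: "\<pi> \<in> martingales" and i: "i \<in> {1..d}"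
  shows "(\<integral>w. w i \<partial>\<pi>) = mean \<pi>"
proof -
  have "i \<le> d" using i by simp
  then show ?thesis
    using i
  proof (induction rule: inc_induct)
    case (step k)
    have k: "k \<in> {1..<d}" using step by auto
    have "(\<integral>w. w (Suc k) - w k \<partial>\<pi>) = 0"
      using \<pi> k unfolding martingales_iff by (elim conjE ballE[of _ _ k] allE[of _ "\<lambda>i x. 1"]) simp_all
    moreover have "integrable \<pi> (\<lambda>w. w (Suc k))" "integrable \<pi> (\<lambda>w. w k)"
      using k by (auto intro!: integrable_path_continuous martingales_laws \<pi> path_continuous_coord_id simp del: One_nat_def)
    ultimately have "(\<integral>w. w (Suc k) \<partial>\<pi>) = (\<integral>w. w k \<partial>\<pi>)" by simp
    then show ?case using step k by auto
  qed simp
qed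

lemma mean_in_interval:
  assumes "\<pi> \<in> laws"
  shows "a \<le> mean \<pi>" "mean \<pi> \<le> b"
proof -
  interpret prob_space \<pi> by (rule lawsD(1)[OF assms])
  have int: "integrable \<pi> (\<lambda>w. w d)"
    by (intro integrable_path_continuous assms path_continuous_coord_id last_coord)
  have "a \<le> w d" "w d \<le> b" if "w \<in> space \<pi>" for w
    using that last_coord unfolding lawsD(3)[OF assms] by (auto dest!: PiE_mem)
  then show "a \<le> mean \<pi>" "mean \<pi> \<le> b"
    by (auto intro!: integral_ge_const integral_le_const int AE_I2)
qed

text \<open>
  Replacing the first k coordinates of a martingale by its mean leaves a martingale: the process
  waits at the mean up to time k and then runs as before. This waiting period links the values of
  the dynamic program at consecutive times.
\<close>

definition freeze :: "nat \<Rightarrow> real \<Rightarrow> (nat \<Rightarrow> real) \<Rightarrow> nat \<Rightarrow> real" where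
  "freeze k y w = (\<lambda>i\<in>{1..d}. if i \<le> k then y else w i)"

lemma freeze_measurable:
  assumes "a \<le> y" "y \<le> b"
  shows "freeze k y \<in> P \<rightarrow>\<^sub>M P"
proof -
  have "(\<lambda>w. if i \<le> k then y else w i) \<in> P \<rightarrow>\<^sub>M restrict_space borel {a..b}" if i: "i \<in> {1..d}" for i
    using assms measurable_component_singleton[OF i, of "\<lambda>_. restrict_space borel {a..b}"]
    by (cases "i \<le> k") (auto simp: path_space_def intro!: measurable_const)
  then show ?thesis
    unfolding freeze_def path_space_def by (intro measurable_restrict) simp
qed

lemma freeze_laws:
  assumes "\<pi> \<in> laws" "a \<le> y" "y \<le> b"
  shows "distr \<pi> P (freeze k y) \<in> laws"
proof -
  interpret prob_space \<pi> by (rule lawsD(1)[OF assms(1)])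
  show ?thesis
    using freeze_measurable[OF assms(2,3)]
    by (auto simp: space_prob_algebra measurable_path[OF assms(1)] intro!: prob_space_distr)
qed

lemma integral_freeze:
  assumes "\<pi> \<in> laws" "a \<le> y" "y \<le> b" "path_continuous d f"
  shows "(\<integral>w. f w \<partial>distr \<pi> P (freeze k y)) = (\<integral>w. f (freeze k y w) \<partial>\<pi>)"
  using freeze_measurable[OF assms(2,3)] borel_measurable_path_continuous[OF assms(4)]
  by (intro integral_distr) (simp_all add: measurable_path[OF assms(1)])

lemma freeze_martingale:
  assumes \<pi>: "\<pi> \<in> martingales"
  shows "distr \<pi> P (freeze k (mean \<pi>)) \<in> martingales"
proof -
  define y where "y = mean \<pi>"
  note law = martingales_laws[OF \<pi>]
  interpret prob_space \<pi> by (rule lawsD(1)[OF law])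
  have y: "a \<le> y" "y \<le> b" unfolding y_def using mean_in_interval[OF law] by auto
  show ?thesis
    unfolding martingales_iff y_def[symmetric]
  proof (intro conjI ballI allI impI freeze_laws law y)
    fix j and \<phi> :: "nat \<Rightarrow> real \<Rightarrow> real"
    assume j: "j \<in> {1..<d}" and \<phi>: "\<forall>i. continuous_on UNIV (\<phi> i)"
    \<comment> \<open>factors at frozen times become constants, so the test function stays a product\<close>
    define \<psi> where "\<psi> i = (if i \<le> k then (\<lambda>_. \<phi> i y) else \<phi> i)" for i
    have "(\<integral>w. (w (Suc j) - w j) * (\<Prod>i\<in>{1..j}. \<phi> i (w i)) \<partial>distr \<pi> P (freeze k y))
        = (\<integral>w. (freeze k y w (Suc j) - freeze k y w j) * (\<Prod>i\<in>{1..j}. \<phi> i (freeze k y w i)) \<partial>\<pi>)"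
      by (intro integral_freeze law y path_continuous_test j) (use \<phi> in auto)
    also have "\<dots> = (\<integral>w. (freeze k y w (Suc j) - freeze k y w j) * (\<Prod>i\<in>{1..j}. \<psi> i (w i)) \<partial>\<pi>)"
    proof -
      have "(\<Prod>i\<in>{1..j}. \<phi> i (freeze k y w i)) = (\<Prod>i\<in>{1..j}. \<psi> i (w i))" for w
        using j by (intro prod.cong) (auto simp: freeze_def \<psi>_def)
      then show ?thesis by simp
    qed
    also have "\<dots> = 0"
    proof -
      consider "j < k" | "j = k" | "k < j" by linarith
      then show ?thesis
      proof cases
        case 1
        then have "freeze k y w (Suc j) - freeze k y w j = 0" for w
          using j by (simp add: freeze_def)
        then show ?thesis by simp
      next
        case 2
        have "(freeze k y w (Suc j) - freeze k y w j) * (\<Prod>i\<in>{1..j}. \<psi> i (w i))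
           = (w (Suc j) - y) * (\<Prod>i\<in>{1..j}. \<phi> i y)" for w
          using j 2 by (simp add: freeze_def \<psi>_def)
        moreover have "integrable \<pi> (\<lambda>w. w (Suc j))"
          using j by (intro integrable_path_continuous law path_continuous_coord_id) auto
        moreover have "(\<integral>w. w (Suc j) \<partial>\<pi>) = y"
          unfolding y_def using j by (intro expectation_coord \<pi>) auto
        ultimately show ?thesis by (simp add: prob_space)
      next
        case 3
        then have "freeze k y w (Suc j) - freeze k y w j = w (Suc j) - w j" for w
          using j by (simp add: freeze_def)
        moreover have "\<forall>i. continuous_on UNIV (\<psi> i)"
          using \<phi> by (simp add: \<psi>_def)
        ultimately show ?thesis
          using \<pi> j unfolding martingales_iff by simp
      qed
    qed
    finally show "(\<integral>w. (w (Suc j) - w j) * (\<Prod>i\<in>{1..j}. \<phi> i (w i)) \<partial>distr \<pi> P (freeze k y)) = 0" .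
  qed
qed

lemma constant_martingale:
  assumes x: "a \<le> x" "x \<le> b"
  obtains \<pi> where "\<pi> \<in> martingales" "mean \<pi> = x"
proof
  define c where "c = (\<lambda>i\<in>{1..d}. x)"
  have c: "c \<in> space P"
    using x by (auto simp: space_path c_def)
  have eval: "(\<integral>w. f w \<partial>return P c) = f c" if "path_continuous d f" for f
    by (intro integral_return c borel_measurable_path_continuous that)
  show "return P c \<in> martingales"
    unfolding martingales_iff
  proof (intro conjI ballI allI impI)
    show "return P c \<in> laws"
      using c by (simp add: space_prob_algebra prob_space_return)
    fix k and \<phi> :: "nat \<Rightarrow> real \<Rightarrow> real"
    assume k: "k \<in> {1..<d}" and \<phi>: "\<forall>i. continuous_on UNIV (\<phi> i)"
    have "path_continuous d (\<lambda>x. (x (Suc k) - x k) * (\<Prod>i\<in>{1..k}. \<phi> i (x i)))"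
      using k \<phi> by (intro path_continuous_test) auto
    from eval[OF this] show "(\<integral>x. (x (Suc k) - x k) * (\<Prod>i\<in>{1..k}. \<phi> i (x i)) \<partial>return P c) = 0"
      using k by (simp add: c_def)
  qed
  show "mean (return P c) = x"
    using eval[OF path_continuous_coord_id[OF last_coord]] last_coord by (simp add: c_def)
qed

context
  fixes g :: "nat \<Rightarrow> real \<Rightarrow> real" and L :: real
  assumes lipschitz: "\<bar>g i s - g i t\<bar> \<le> L * \<bar>s - t\<bar>" and L: "0 \<le> L"
begin

lemma continuous_g: "continuous_on UNIV (g i)"
  by (rule lipschitz_on_continuous_on[of L], rule lipschitz_onI) (simp_all add: dist_real_def lipschitz L)

lemma path_continuous_tail: "1 \<le> k \<Longrightarrow> path_continuous d (\<lambda>w. \<Sum>i=k..d. g i (w i))"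
  by (intro continuous_map_sum path_continuous_coord continuous_g) auto

text \<open>
  The remaining cost from time k on. Starting at x would be the constraint that the mean is x, but
  a value function on [a, b] may fail to extend to a convex function on the line. The penalty
  replaces the constraint and makes the value function convex and Lipschitz on all of \<real>. Its weight
  grows with k by the Lipschitz constant L, which is what bellman_step consumes, and vanishes for k = 1,
  where the start is free.
\<close>

definition cost :: "nat \<Rightarrow> real \<Rightarrow> (nat \<Rightarrow> real) measure \<Rightarrow> real" where
  "cost k x \<pi> = (\<integral>w. (\<Sum>i=k..d. g i (w i)) \<partial>\<pi>) + (real k - 1) * L * \<bar>x - mean \<pi>\<bar>"

definition bellman :: "nat \<Rightarrow> real \<Rightarrow> real" where
  "bellman k x = (INF \<pi>\<in>martingales. cost k x \<pi>)"

lemma tail_bounded: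
  assumes "1 \<le> k"
  obtains C where "0 \<le> C" "\<And>\<pi>. \<pi> \<in> martingales \<Longrightarrow> \<bar>\<integral>w. (\<Sum>i=k..d. g i (w i)) \<partial>\<pi>\<bar> \<le> C"
  using path_continuous_expectation_bounded[OF path_continuous_tail[OF assms]] martingales_laws by metis

lemma bellman_le:
  assumes "1 \<le> k" "\<pi> \<in> martingales"
  shows "bellman k x \<le> cost k x \<pi>"
proof -
  obtain C where C: "\<And>\<pi>. \<pi> \<in> martingales \<Longrightarrow> \<bar>\<integral>w. (\<Sum>i=k..d. g i (w i)) \<partial>\<pi>\<bar> \<le> C"
    using tail_bounded[OF assms(1)] by blast
  have "- C \<le> cost k x \<rho>" if "\<rho> \<in> martingales" for \<rho>
  proof -
    have "0 \<le> (real k - 1) * L * \<bar>x - mean \<rho>\<bar>" using assms(1) L by simp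
    then show ?thesis using C[OF that] unfolding cost_def by linarith
  qed
  then have "bdd_below (cost k x ` martingales)" by (rule bdd_belowI2)
  then show ?thesis unfolding bellman_def using assms(2) by (rule cINF_lower)
qed

lemma bellman_ge: "(\<And>\<pi>. \<pi> \<in> martingales \<Longrightarrow> c \<le> cost k x \<pi>) \<Longrightarrow> c \<le> bellman k x"
  unfolding bellman_def using constant_martingale[OF order_refl interval_nonempty]
  by (intro cINF_greatest) blast+

lemma bellman_approx:
  assumes "0 < e"
  obtains \<pi> where "\<pi> \<in> martingales" "cost k x \<pi> < bellman k x + e"
proof -
  have "\<not> (\<forall>\<pi>\<in>martingales. bellman k x + e \<le> cost k x \<pi>)"
    using bellman_ge[of "bellman k x + e" k x] assms by auto
  then show thesis using that by (auto simp: not_le)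
qed

text \<open>
  The cost is jointly convex in the starting point and the law, and mixtures of martingales are
  martingales.
\<close>

lemma convex_bellman:
  assumes k: "1 \<le> k"
  shows "convex_on UNIV (bellman k)"
proof (rule convex_onI)
  fix t x y :: real assume t: "0 < t" "t < 1"
  show "bellman k ((1 - t) *\<^sub>R x + t *\<^sub>R y) \<le> (1 - t) * bellman k x + t * bellman k y"
  proof (rule field_le_epsilon)
    fix e :: real assume e: "0 < e"
    obtain \<pi> where \<pi>: "\<pi> \<in> martingales" "cost k x \<pi> < bellman k x + e" using bellman_approx[OF e] .
    obtain \<rho> where \<rho>: "\<rho> \<in> martingales" "cost k y \<rho> < bellman k y + e" using bellman_approx[OF e] .
    define m where "m = mixture (1 - t) \<pi> \<rho>"
    have m: "m \<in> martingales"
      unfolding m_def using t by (intro mixture_martingales \<pi> \<rho>) auto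
    have mix: "(\<integral>w. f w \<partial>m) = (1 - t) * (\<integral>w. f w \<partial>\<pi>) + t * (\<integral>w. f w \<partial>\<rho>)" if "path_continuous d f" for f
      unfolding m_def using t integral_mixture_path[OF martingales_laws[OF \<pi>(1)] martingales_laws[OF \<rho>(1)] _ _ that, of "1 - t"]
      by simp
    have "\<bar>(1 - t) * x + t * y - mean m\<bar> = \<bar>(1 - t) * (x - mean \<pi>) + t * (y - mean \<rho>)\<bar>"
      using mix[OF path_continuous_coord_id[OF last_coord]] by (simp add: algebra_simps)
    also have "\<dots> \<le> (1 - t) * \<bar>x - mean \<pi>\<bar> + t * \<bar>y - mean \<rho>\<bar>"
      using t by (intro order_trans[OF abs_triangle_ineq]) (simp add: abs_mult)
    finally have "(real k - 1) * L * \<bar>(1 - t) * x + t * y - mean m\<bar>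
        \<le> (real k - 1) * L * ((1 - t) * \<bar>x - mean \<pi>\<bar> + t * \<bar>y - mean \<rho>\<bar>)"
      using k L by (intro mult_left_mono) auto
    then have "cost k ((1 - t) * x + t * y) m \<le> (1 - t) * cost k x \<pi> + t * cost k y \<rho>"
      unfolding cost_def mix[OF path_continuous_tail[OF k]] by (simp add: algebra_simps)
    also have "\<dots> \<le> (1 - t) * (bellman k x + e) + t * (bellman k y + e)"
      using \<pi>(2) \<rho>(2) t by (intro add_mono mult_left_mono) auto
    finally show "bellman k ((1 - t) *\<^sub>R x + t *\<^sub>R y) \<le> (1 - t) * bellman k x + t * bellman k y + e"
      using bellman_le[OF k m, of "(1 - t) * x + t * y"] by (simp add: algebra_simps)
  qed
qed simp

lemma linear_growth_bellman:
  assumes k: "1 \<le> k"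
  shows "\<exists>C. \<forall>x. \<bar>bellman k x\<bar> \<le> C * (1 + \<bar>x\<bar>)"
proof -
  obtain C where C: "0 \<le> C" "\<And>\<pi>. \<pi> \<in> martingales \<Longrightarrow> \<bar>\<integral>w. (\<Sum>i=k..d. g i (w i)) \<partial>\<pi>\<bar> \<le> C"
    using tail_bounded[OF assms(1)] by blast
  obtain \<pi> where \<pi>: "\<pi> \<in> martingales" "mean \<pi> = a"
    using constant_martingale[OF order_refl interval_nonempty] .
  define K where "K = (real k - 1) * L"
  have K: "0 \<le> K" using k L by (simp add: K_def)
  have "\<bar>bellman k x\<bar> \<le> (C + K * (1 + \<bar>a\<bar>)) * (1 + \<bar>x\<bar>)" for x
  proof -
    have "- C \<le> bellman k x"
    proof (rule bellman_ge)
      fix \<rho> assume "\<rho> \<in> martingales"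
      moreover have "0 \<le> K * \<bar>x - mean \<rho>\<bar>" using K by simp
      ultimately show "- C \<le> cost k x \<rho>" using C(2)[of \<rho>] unfolding cost_def K_def by linarith
    qed
    moreover have "bellman k x \<le> C + K * \<bar>x - a\<bar>"
      using bellman_le[OF k \<pi>(1), of x] C(2)[OF \<pi>(1)] unfolding cost_def K_def \<pi>(2) by linarith
    moreover have "K * \<bar>x - a\<bar> \<le> K * (\<bar>x\<bar> + \<bar>a\<bar>)"
      using K by (intro mult_left_mono) auto
    ultimately have "\<bar>bellman k x\<bar> \<le> C + K * (\<bar>x\<bar> + \<bar>a\<bar>)"
      using C(1) K by (simp add: abs_le_iff add_increasing2)
    also have "\<dots> \<le> C + K * (\<bar>x\<bar> + \<bar>a\<bar>) + (C * \<bar>x\<bar> + K + K * (\<bar>a\<bar> * \<bar>x\<bar>))"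
      using C(1) K by simp
    also have "\<dots> = (C + K * (1 + \<bar>a\<bar>)) * (1 + \<bar>x\<bar>)"
      by (simp add: algebra_simps)
    finally show ?thesis .
  qed
  then show ?thesis by blast
qed

text \<open>
  Freeze a competitor for time k + 1 up to time k at its mean y. The new law pays g k y instead of
  g k x, and L \<bar>x - y\<bar> of the penalty covers the difference.
\<close>

lemma bellman_step:
  assumes k: "k \<in> {1..d}"
  shows "bellman k x \<le> g k x + bellman (Suc k) x"
proof -
  have "bellman k x - g k x \<le> bellman (Suc k) x"
  proof (rule bellman_ge)
    fix \<pi> assume \<pi>: "\<pi> \<in> martingales"
    note law = martingales_laws[OF \<pi>]
    interpret prob_space \<pi> by (rule lawsD(1)[OF law])
    define y where "y = mean \<pi>"
    have y: "a \<le> y" "y \<le> b" using mean_in_interval[OF law] by (auto simp: y_def)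
    define \<rho> where "\<rho> = distr \<pi> P (freeze k y)"
    have \<rho>: "\<rho> \<in> martingales"
      unfolding \<rho>_def y_def by (rule freeze_martingale[OF \<pi>])
    have tail: "integrable \<pi> (\<lambda>w. \<Sum>i=Suc k..d. g i (w i))"
      by (intro integrable_path_continuous law path_continuous_tail) simp
    have "(\<Sum>i=k..d. g i (freeze k y w i)) = g k y + (\<Sum>i=Suc k..d. g i (w i))" for w
    proof -
      have "(\<Sum>i=k..d. g i (freeze k y w i)) = g k (freeze k y w k) + (\<Sum>i=Suc k..d. g i (freeze k y w i))"
        using k by (simp add: sum.atLeast_Suc_atMost)
      moreover have "(\<Sum>i=Suc k..d. g i (freeze k y w i)) = (\<Sum>i=Suc k..d. g i (w i))"
        by (intro sum.cong) (auto simp: freeze_def)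
      ultimately show ?thesis using k by (simp add: freeze_def)
    qed
    then have "(\<integral>w. (\<Sum>i=k..d. g i (w i)) \<partial>\<rho>) = g k y + (\<integral>w. (\<Sum>i=Suc k..d. g i (w i)) \<partial>\<pi>)"
      unfolding \<rho>_def using k tail
      by (subst integral_freeze[OF law y path_continuous_tail]) (auto simp: prob_space)
    moreover have "mean \<rho> = y"
    proof (cases "k = d")
      case True
      then have "freeze k y w d = y" for w using last_coord by (simp add: freeze_def)
      then show ?thesis
        unfolding \<rho>_def
        by (subst integral_freeze[OF law y path_continuous_coord_id[OF last_coord]]) (simp add: prob_space)
    next
      case False
      then have "freeze k y w d = w d" for w using k last_coord by (simp add: freeze_def)
      then show ?thesis
        unfolding \<rho>_def
        by (subst integral_freeze[OF law y path_continuous_coord_id[OF last_coord]]) (simp add: y_def)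
    qed
    ultimately have "bellman k x \<le> g k y + (\<integral>w. (\<Sum>i=Suc k..d. g i (w i)) \<partial>\<pi>) + (real k - 1) * L * \<bar>x - y\<bar>"
      using bellman_le[OF _ \<rho>, of k x] k by (simp add: cost_def)
    moreover have "g k y \<le> g k x + L * \<bar>x - y\<bar>"
      using lipschitz[of k x y] by linarith
    ultimately show "bellman k x - g k x \<le> cost (Suc k) x \<pi>"
      unfolding cost_def y_def[symmetric] by (simp add: algebra_simps)
  qed
  then show ?thesis by simp
qed

lemma bellman_final:
  assumes "a \<le> x" "x \<le> b"
  shows "bellman (Suc d) x \<le> 0"
proof -
  obtain \<pi> where "\<pi> \<in> martingales" "mean \<pi> = x" using constant_martingale[OF assms] .
  then show ?thesis
    using bellman_le[of "Suc d" \<pi> x] by (simp add: cost_def)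
qed

text \<open>
  Integrate bellman_step against \<nu> k and replace \<nu> k by \<nu> (k + 1) in the last term, which convex
  order permits because the value function is convex with linear growth. Telescoping bounds the value
  at time 1, the infimum over all martingales, by the integrals of the g k.
\<close>

proposition martingale_below_marginals:
  fixes \<nu> :: "nat \<Rightarrow> real measure"
  assumes prob: "\<And>i. i \<in> {1..d} \<Longrightarrow> prob_space (\<nu> i)"
    and meas: "\<And>i. i \<in> {1..d} \<Longrightarrow> (\<lambda>x. x) \<in> borel_measurable (\<nu> i)"
    and space: "\<And>i. i \<in> {1..d} \<Longrightarrow> space (\<nu> i) \<subseteq> {a..b}"
    and order: "\<And>i. i \<in> {1..<d} \<Longrightarrow> convex_order (\<nu> i) (\<nu> (Suc i))"
    and \<delta>: "0 < \<delta>"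
  obtains \<pi> where "\<pi> \<in> martingales" "(\<integral>w. (\<Sum>i=1..d. g i (w i)) \<partial>\<pi>) < (\<Sum>i=1..d. \<integral>x. g i x \<partial>\<nu> i) + \<delta>"
proof -
  have int: "integrable (\<nu> i) \<phi>" if i: "i \<in> {1..d}" and \<phi>: "continuous_on UNIV \<phi>" for i and \<phi> :: "real \<Rightarrow> real"
    using integrable_continuous_on_interval[OF prob[OF i] meas[OF i] space[OF i] \<phi>] .
  have int_bellman: "integrable (\<nu> i) (bellman k)" if "i \<in> {1..d}" "1 \<le> k" for i k
    by (intro int that convex_on_continuous convex_bellman) auto
  have int_g: "integrable (\<nu> i) (g k)" if "i \<in> {1..d}" for i k
    by (intro int that continuous_g)
  have step: "(\<integral>x. bellman k x \<partial>\<nu> k) \<le> (\<integral>x. g k x \<partial>\<nu> k) + (\<integral>x. bellman (Suc k) x \<partial>\<nu> k)" if k: "k \<in> {1..d}" for k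
  proof -
    have "(\<integral>x. bellman k x \<partial>\<nu> k) \<le> (\<integral>x. g k x + bellman (Suc k) x \<partial>\<nu> k)"
      using k by (intro integral_mono Bochner_Integration.integrable_add int_bellman int_g bellman_step) auto
    also have "\<dots> = (\<integral>x. g k x \<partial>\<nu> k) + (\<integral>x. bellman (Suc k) x \<partial>\<nu> k)"
      using k by (intro Bochner_Integration.integral_add int_bellman int_g) auto
    finally show ?thesis .
  qed
  have chain: "bellman 1 0 \<le> (\<Sum>i\<in>{1..<k}. \<integral>x. g i x \<partial>\<nu> i) + (\<integral>x. bellman k x \<partial>\<nu> k)" if "1 \<le> k" "k \<le> d" for k
    using that
  proof (induction k rule: nat_induct_at_least)
    case base
    interpret prob_space "\<nu> 1" by (rule prob) (use horizon in auto)
    \<comment> \<open>the penalty has weight 0 at time 1\<close>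
    have "bellman 1 x = bellman 1 0" for x by (simp add: bellman_def cost_def)
    then have "(\<integral>x. bellman 1 x \<partial>\<nu> 1) = (\<integral>x. bellman 1 0 \<partial>\<nu> 1)" by metis
    then show ?case by (simp add: prob_space del: One_nat_def)
  next
    case (Suc k)
    have "(\<integral>x. bellman (Suc k) x \<partial>\<nu> k) \<le> (\<integral>x. bellman (Suc k) x \<partial>\<nu> (Suc k))"
      using order[of k] Suc convex_bellman[of "Suc k"] linear_growth_bellman[of "Suc k"]
      unfolding convex_order_def by auto
    then show ?case
      using Suc.IH Suc.prems Suc.hyps step[of k] by simp
  qed
  have "bellman 1 0 \<le> (\<Sum>i\<in>{1..<d}. \<integral>x. g i x \<partial>\<nu> i) + (\<integral>x. g d x \<partial>\<nu> d) + (\<integral>x. bellman (Suc d) x \<partial>\<nu> d)"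
    using chain[OF horizon order_refl] step[OF last_coord] by simp
  also have "(\<integral>x. bellman (Suc d) x \<partial>\<nu> d) \<le> 0"
  proof -
    interpret prob_space "\<nu> d" by (rule prob[OF last_coord])
    show ?thesis
      using space[OF last_coord] bellman_final by (intro integral_le_const int_bellman last_coord AE_I2) auto
  qed
  also have "(\<Sum>i\<in>{1..<d}. \<integral>x. g i x \<partial>\<nu> i) + (\<integral>x. g d x \<partial>\<nu> d) + 0 = (\<Sum>i=1..d. \<integral>x. g i x \<partial>\<nu> i)"
    using horizon by (simp add: sum.last_plus atLeastLessThanSuc_atLeastAtMost[symmetric])
  finally have "bellman 1 0 \<le> (\<Sum>i=1..d. \<integral>x. g i x \<partial>\<nu> i)" by simp
  moreover obtain \<pi> where "\<pi> \<in> martingales" "cost 1 0 \<pi> < bellman 1 0 + \<delta>" using bellman_approx[OF \<delta>] .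
  ultimately show thesis using that by (simp add: cost_def)
qed

end
end

section \<open>Strassen's theorem on a cube\<close>

context cube
begin

context
  fixes \<nu> :: "nat \<Rightarrow> real measure"
  assumes prob: "\<And>i. i \<in> {1..d} \<Longrightarrow> prob_space (\<nu> i)"
    and meas: "\<And>i. i \<in> {1..d} \<Longrightarrow> (\<lambda>x. x) \<in> borel_measurable (\<nu> i)"
    and space: "\<And>i. i \<in> {1..d} \<Longrightarrow> space (\<nu> i) \<subseteq> {a..b}"
    and order: "\<And>i. i \<in> {1..<d} \<Longrightarrow> convex_order (\<nu> i) (\<nu> (Suc i))"
begin

lemma integrable_marginal:
  fixes \<phi> :: "real \<Rightarrow> real"
  assumes i: "i \<in> {1..d}" and \<phi>: "continuous_on UNIV \<phi>"
  shows "integrable (\<nu> i) \<phi>"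
  using integrable_continuous_on_interval[OF prob[OF i] meas[OF i] space[OF i] \<phi>] .

text \<open>
  A minimiser \<rho> of the squared error J satisfies the first order condition along the segment to any
  other martingale law. The coefficients \<alpha> of this condition define Lipschitz functions g for which
  martingale_below_marginals contradicts it unless J \<rho> = 0.
\<close>

lemma finitely_many_hinges:
  fixes q :: "nat \<Rightarrow> real"
  obtains \<rho> where "\<rho> \<in> martingales"
    "\<And>i m. i \<in> {1..d} \<Longrightarrow> m < N \<Longrightarrow> (\<integral>w. \<bar>w i - q m\<bar> \<partial>\<rho>) = (\<integral>x. \<bar>x - q m\<bar> \<partial>\<nu> i)"
proof -
  define H where "H \<pi> i m = (\<integral>w. \<bar>w i - q m\<bar> \<partial>\<pi>) - (\<integral>x. \<bar>x - q m\<bar> \<partial>\<nu> i)" for \<pi> i m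
  define J where "J \<pi> = (\<Sum>i=1..d. \<Sum>m<N. (H \<pi> i m)\<^sup>2)" for \<pi>
  have J_nonneg: "0 \<le> J \<pi>" for \<pi>
    unfolding J_def by (intro sum_nonneg) auto
  define s where "s = (INF \<pi>\<in>martingales. J \<pi>)"
  have s_le: "s \<le> J \<pi>" if "\<pi> \<in> martingales" for \<pi>
    unfolding s_def using that J_nonneg by (intro cINF_lower bdd_belowI2)
  have "\<exists>\<pi>\<in>martingales. J \<pi> < s + 1 / real (Suc n)" for n
  proof (rule ccontr)
    assume "\<not> ?thesis"
    then have "s + 1 / real (Suc n) \<le> s"
      using constant_martingale[OF order_refl interval_nonempty] unfolding s_def
      by (intro cINF_greatest) (auto simp: not_less)
    then show False by (simp add: field_simps)
  qed
  then obtain \<pi> where \<pi>: "\<And>n. \<pi> n \<in> martingales" "\<And>n. J (\<pi> n) < s + 1 / real (Suc n)"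
    by metis
  obtain r :: "nat \<Rightarrow> nat" and \<rho> where r: "strict_mono r" and \<rho>: "\<rho> \<in> martingales"
    and lim: "\<And>f. path_continuous d f \<Longrightarrow> (\<lambda>n. \<integral>x. f x \<partial>\<pi> (r n)) \<longlonglongrightarrow> (\<integral>x. f x \<partial>\<rho>)"
    using martingales_sequentially_compact[of \<pi>] \<pi>(1) by blast
  have "(\<lambda>n. J (\<pi> (r n))) \<longlonglongrightarrow> J \<rho>"
    unfolding J_def H_def by (intro tendsto_intros lim path_continuous_hinge) auto
  moreover have "(\<lambda>n. s + 1 / real (Suc (r n))) \<longlonglongrightarrow> s + 0"
    using LIMSEQ_subseq_LIMSEQ[OF LIMSEQ_inverse_real_of_nat r]
    by (intro tendsto_add tendsto_const) (simp add: o_def inverse_eq_divide)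
  ultimately have "J \<rho> \<le> s + 0"
    by (rule LIMSEQ_le) (use \<pi>(2) in \<open>auto intro: less_imp_le\<close>)
  then have minimal: "J \<rho> \<le> J \<pi>" if "\<pi> \<in> martingales" for \<pi>
    using s_le[OF that] by simp
  \<comment> \<open>zero off the index range, so that one Lipschitz constant serves all i below\<close>
  define \<alpha> where "\<alpha> i m = (if i \<in> {1..d} then H \<rho> i m else 0)" for i m
  have first_order: "J \<rho> \<le> (\<Sum>i=1..d. \<Sum>m<N. \<alpha> i m * H \<pi> i m)" if \<pi>: "\<pi> \<in> martingales" for \<pi>
  proof -
    define \<beta> where "\<beta> i m = H \<pi> i m - H \<rho> i m" for i m
    define A where "A = (\<Sum>i=1..d. \<Sum>m<N. \<alpha> i m * \<beta> i m)"
    define Q where "Q = (\<Sum>i=1..d. \<Sum>m<N. (\<beta> i m)\<^sup>2)"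
    \<comment> \<open>J along the segment from \<rho> to \<pi> has its minimum at \<rho>; expand it and divide by t\<close>
    have var: "0 \<le> 2 * A + t * Q" if t: "0 < t" "t \<le> 1" for t
    proof -
      have "H (mixture t \<pi> \<rho>) i m = \<alpha> i m + t * \<beta> i m" if i: "i \<in> {1..d}" for i m
        using integral_mixture_path[OF martingales_laws[OF \<pi>] martingales_laws[OF \<rho>] _ _ path_continuous_hinge[OF i]] t i
        by (simp add: H_def \<alpha>_def \<beta>_def algebra_simps)
      then have "J (mixture t \<pi> \<rho>) = (\<Sum>i=1..d. \<Sum>m<N. (\<alpha> i m + t * \<beta> i m)\<^sup>2)"
        unfolding J_def by simp
      also have "\<dots> = (\<Sum>i=1..d. \<Sum>m<N. (\<alpha> i m)\<^sup>2 + t * (2 * (\<alpha> i m * \<beta> i m) + t * (\<beta> i m)\<^sup>2))"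
        by (intro sum.cong refl) (simp add: power2_eq_square algebra_simps)
      also have "\<dots> = J \<rho> + t * (2 * A + t * Q)"
        unfolding J_def A_def Q_def
        by (simp only: sum.distrib sum_distrib_left[symmetric]) (simp add: \<alpha>_def)
      finally have "0 \<le> t * (2 * A + t * Q)"
        using minimal[OF mixture_martingales[OF \<pi> \<rho>, of t]] t by simp
      then show ?thesis using t by (simp add: zero_le_mult_iff)
    qed
    have "((\<lambda>t. 2 * A + t * Q) \<longlongrightarrow> 2 * A + 0 * Q) (at_right 0)"
      by (intro tendsto_intros)
    moreover have "eventually (\<lambda>t. 0 \<le> 2 * A + t * Q) (at_right (0::real))"
      by (rule eventually_at_rightI[of 0 1]) (auto intro: var)
    ultimately have "0 \<le> 2 * A + 0 * Q"
      by (rule tendsto_lowerbound) simp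
    then have "0 \<le> A" by simp
    moreover have "(\<Sum>i=1..d. \<Sum>m<N. \<alpha> i m * H \<pi> i m) = A + J \<rho>"
    proof -
      have "(\<Sum>i=1..d. \<Sum>m<N. \<alpha> i m * H \<pi> i m) = (\<Sum>i=1..d. \<Sum>m<N. \<alpha> i m * \<beta> i m + (H \<rho> i m)\<^sup>2)"
        by (intro sum.cong refl) (simp add: \<alpha>_def \<beta>_def power2_eq_square algebra_simps)
      then show ?thesis
        by (simp only: A_def J_def sum.distrib)
    qed
    ultimately show ?thesis by simp
  qed
  have "J \<rho> \<le> 0"
  proof (rule ccontr)
    assume "\<not> J \<rho> \<le> 0"
    then have pos: "0 < J \<rho>" by simp
    define g where "g i x = (\<Sum>m<N. \<alpha> i m * \<bar>x - q m\<bar>)" for i x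
    define L where "L = (\<Sum>i=1..d. \<Sum>m<N. \<bar>\<alpha> i m\<bar>)"
    have "0 \<le> L" unfolding L_def by (intro sum_nonneg) auto
    have lip: "\<bar>g i x - g i y\<bar> \<le> L * \<bar>x - y\<bar>" for i x y
    proof (cases "i \<in> {1..d}")
      case True
      have "\<bar>g i x - g i y\<bar> = \<bar>\<Sum>m<N. \<alpha> i m * (\<bar>x - q m\<bar> - \<bar>y - q m\<bar>)\<bar>"
        by (simp only: g_def right_diff_distrib sum_subtractf)
      also have "\<dots> \<le> (\<Sum>m<N. \<bar>\<alpha> i m\<bar> * \<bar>x - y\<bar>)"
        by (rule order_trans[OF sum_abs]) (auto simp: abs_mult intro!: sum_mono mult_left_mono)
      also have "\<dots> \<le> L * \<bar>x - y\<bar>"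
        unfolding L_def sum_distrib_right[symmetric] using True
        by (intro mult_right_mono member_le_sum[where f="\<lambda>i. \<Sum>m<N. \<bar>\<alpha> i m\<bar>"]) (auto intro: sum_nonneg)
      finally show ?thesis .
    next
      case False
      then show ?thesis using \<open>0 \<le> L\<close> by (simp only: g_def \<alpha>_def if_False) simp
    qed
    obtain \<pi> where \<pi>: "\<pi> \<in> martingales"
      and less: "(\<integral>w. (\<Sum>i=1..d. g i (w i)) \<partial>\<pi>) < (\<Sum>i=1..d. \<integral>x. g i x \<partial>\<nu> i) + J \<rho>"
      using martingale_below_marginals[where g=g and \<nu>=\<nu>, OF lip \<open>0 \<le> L\<close> prob meas space order pos] by blast
    have "(\<integral>w. (\<Sum>i=1..d. g i (w i)) \<partial>\<pi>) = (\<Sum>i=1..d. \<Sum>m<N. \<alpha> i m * (\<integral>w. \<bar>w i - q m\<bar> \<partial>\<pi>))"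
    proof -
      have int: "integrable \<pi> (\<lambda>w. \<alpha> i m * \<bar>w i - q m\<bar>)" if "i \<in> {1..d}" for i m
        by (intro integrable_mult_right integrable_path_continuous martingales_laws \<pi> path_continuous_hinge that)
      have "(\<integral>w. (\<Sum>i=1..d. g i (w i)) \<partial>\<pi>) = (\<Sum>i=1..d. \<Sum>m<N. \<integral>w. \<alpha> i m * \<bar>w i - q m\<bar> \<partial>\<pi>)"
        unfolding g_def
        by (subst Bochner_Integration.integral_sum,
            force intro!: Bochner_Integration.integrable_sum int,
            intro sum.cong refl Bochner_Integration.integral_sum int)
      then show ?thesis by simp
    qed
    moreover have "(\<Sum>i=1..d. \<integral>x. g i x \<partial>\<nu> i) = (\<Sum>i=1..d. \<Sum>m<N. \<alpha> i m * (\<integral>x. \<bar>x - q m\<bar> \<partial>\<nu> i))"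
    proof (rule sum.cong[OF refl])
      fix i assume i: "i \<in> {1..d}"
      have "(\<integral>x. g i x \<partial>\<nu> i) = (\<Sum>m<N. \<integral>x. \<alpha> i m * \<bar>x - q m\<bar> \<partial>\<nu> i)"
        unfolding g_def
        by (intro Bochner_Integration.integral_sum integrable_marginal[OF i]) (auto intro!: continuous_intros)
      then show "(\<integral>x. g i x \<partial>\<nu> i) = (\<Sum>m<N. \<alpha> i m * (\<integral>x. \<bar>x - q m\<bar> \<partial>\<nu> i))" by simp
    qed
    ultimately have "(\<Sum>i=1..d. \<Sum>m<N. \<alpha> i m * H \<pi> i m) < J \<rho>"
      using less by (simp add: H_def right_diff_distrib sum_subtractf)
    with first_order[OF \<pi>] show False by simp
  qed
  then have "J \<rho> = 0" using J_nonneg[of \<rho>] by simp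
  then have zero: "H \<rho> i m = 0" if "i \<in> {1..d}" "m < N" for i m
    using that unfolding J_def
    by (subst (asm) sum_nonneg_eq_0_iff) (auto intro!: sum_nonneg simp: sum_nonneg_eq_0_iff)
  show thesis
    using zero by (intro that[OF \<rho>]) (simp add: H_def)
qed

text \<open>Match the hinges at the first N rationals and let N tend to infinity.\<close>

proposition martingale_with_hinges:
  obtains \<rho> where "\<rho> \<in> martingales"
    "\<And>i p. i \<in> {1..d} \<Longrightarrow> (\<integral>w. \<bar>w i - p\<bar> \<partial>\<rho>) = (\<integral>x. \<bar>x - p\<bar> \<partial>\<nu> i)"
proof -
  define q :: "nat \<Rightarrow> real" where "q m = of_rat (from_nat m)" for m
  have "\<exists>\<pi>\<in>martingales. \<forall>i\<in>{1..d}. \<forall>m<N. (\<integral>w. \<bar>w i - q m\<bar> \<partial>\<pi>) = (\<integral>x. \<bar>x - q m\<bar> \<partial>\<nu> i)" for N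
    using finitely_many_hinges[of N q] by metis
  then obtain \<pi> where \<pi>: "\<And>N. \<pi> N \<in> martingales"
    "\<And>N i m. i \<in> {1..d} \<Longrightarrow> m < N \<Longrightarrow> (\<integral>w. \<bar>w i - q m\<bar> \<partial>\<pi> N) = (\<integral>x. \<bar>x - q m\<bar> \<partial>\<nu> i)"
    by metis
  obtain r :: "nat \<Rightarrow> nat" and \<rho> where r: "strict_mono r" and \<rho>: "\<rho> \<in> martingales"
    and lim: "\<And>f. path_continuous d f \<Longrightarrow> (\<lambda>n. \<integral>x. f x \<partial>\<pi> (r n)) \<longlonglongrightarrow> (\<integral>x. f x \<partial>\<rho>)"
    using martingales_sequentially_compact[of \<pi>] \<pi>(1) by blast
  have rational: "(\<integral>w. \<bar>w i - q m\<bar> \<partial>\<rho>) = (\<integral>x. \<bar>x - q m\<bar> \<partial>\<nu> i)" if i: "i \<in> {1..d}" for i m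
  proof -
    have "eventually (\<lambda>n. (\<integral>w. \<bar>w i - q m\<bar> \<partial>\<pi> (r n)) = (\<integral>x. \<bar>x - q m\<bar> \<partial>\<nu> i)) sequentially"
      using eventually_gt_at_top[of m]
    proof eventually_elim
      case (elim n)
      then show ?case using \<pi>(2)[OF i, of m "r n"] seq_suble[OF r, of n] by simp
    qed
    then have "(\<lambda>n. \<integral>w. \<bar>w i - q m\<bar> \<partial>\<pi> (r n)) \<longlonglongrightarrow> (\<integral>x. \<bar>x - q m\<bar> \<partial>\<nu> i)"
      by (rule tendsto_eventually)
    with lim[OF path_continuous_hinge[OF i, of "q m"]] show ?thesis
      by (rule LIMSEQ_unique)
  qed
  have "(\<integral>w. \<bar>w i - p\<bar> \<partial>\<rho>) = (\<integral>x. \<bar>x - p\<bar> \<partial>\<nu> i)" if i: "i \<in> {1..d}" for i p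
  proof -
    have "\<bar>(\<integral>w. \<bar>w i - p\<bar> \<partial>\<rho>) - (\<integral>x. \<bar>x - p\<bar> \<partial>\<nu> i)\<bar> \<le> 0 + e" if "0 < e" for e
    proof -
      obtain z where "z \<in> \<rat>" "p - e / 2 < z" "z < p + e / 2"
        using Rats_dense_in_real[of "p - e / 2" "p + e / 2"] \<open>0 < e\<close> by auto
      then obtain m where m: "\<bar>p - q m\<bar> < e / 2"
        unfolding q_def Rats_def
        by (metis (no_types, lifting) abs_diff_less_iff abs_minus_commute from_nat_to_nat rangeE)
      have "integrable \<rho> (\<lambda>w. w i)"
        by (intro integrable_path_continuous martingales_laws \<rho> path_continuous_coord_id i)
      then have "\<bar>(\<integral>w. \<bar>w i - p\<bar> \<partial>\<rho>) - (\<integral>w. \<bar>w i - q m\<bar> \<partial>\<rho>)\<bar> \<le> \<bar>p - q m\<bar>"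
        by (rule integral_hinge_lipschitz[OF lawsD(1)[OF martingales_laws[OF \<rho>]]])
      moreover have "\<bar>(\<integral>x. \<bar>x - p\<bar> \<partial>\<nu> i) - (\<integral>x. \<bar>x - q m\<bar> \<partial>\<nu> i)\<bar> \<le> \<bar>p - q m\<bar>"
        by (intro integral_hinge_lipschitz prob i integrable_marginal continuous_intros)
      ultimately show ?thesis
        using rational[OF i, of m] m by linarith
    qed
    then have "\<bar>(\<integral>w. \<bar>w i - p\<bar> \<partial>\<rho>) - (\<integral>x. \<bar>x - p\<bar> \<partial>\<nu> i)\<bar> \<le> 0"
      by (rule field_le_epsilon)
    then show ?thesis by simp
  qed
  with \<rho> that show thesis by blast
qed

end
end

section \<open>Strassen's theorem on a box\<close>

lemma marginal_measurable:
  "i \<in> {1..d} \<Longrightarrow> (\<lambda>w. w i) \<in> path_space d \<Omega> \<rightarrow>\<^sub>M restrict_space borel (\<Omega> i)"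
  unfolding path_space_def by (rule measurable_component_singleton)

locale box_marginals = box +
  fixes \<nu> :: "nat \<Rightarrow> real measure"
  assumes horizon: "1 \<le> d"
    and marginal_laws: "i \<in> {1..d} \<Longrightarrow> \<nu> i \<in> space (prob_algebra (restrict_space borel (\<Omega> i)))"
begin

abbreviation "transports \<equiv> measures_with_marginals d \<Omega> \<nu>"

lemma marginalD:
  assumes i: "i \<in> {1..d}"
  shows "prob_space (\<nu> i)" "sets (\<nu> i) = sets (restrict_space borel (\<Omega> i))" "space (\<nu> i) = \<Omega> i"
    "(\<lambda>x. x) \<in> borel_measurable (\<nu> i)"
proof -
  show "prob_space (\<nu> i)" and sets: "sets (\<nu> i) = sets (restrict_space borel (\<Omega> i))"
    using marginal_laws[OF i] by (auto simp: space_prob_algebra)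
  from sets_eq_imp_space_eq[OF sets] show "space (\<nu> i) = \<Omega> i"
    by (simp add: space_restrict_space)
  show "(\<lambda>x. x) \<in> borel_measurable (\<nu> i)"
    unfolding measurable_cong_sets[OF sets refl] by (simp add: measurable_restrict_space1)
qed

lemma integrable_marginal_id: "i \<in> {1..d} \<Longrightarrow> integrable (\<nu> i) (\<lambda>x. x)"
  by (rule integrable_continuous_on_interval[where a="l i" and b="u i"]) (simp_all add: marginalD box_eq)

text \<open>
  Describing the marginals by integrals of continuous functions makes the set of laws with these
  marginals visibly convex and weakly closed.
\<close>

lemma transports_iff:
  "\<pi> \<in> transports \<longleftrightarrow> \<pi> \<in> laws \<and> (\<forall>i\<in>{1..d}. \<forall>q. (\<integral>w. \<bar>w i - q\<bar> \<partial>\<pi>) = (\<integral>x. \<bar>x - q\<bar> \<partial>\<nu> i))"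
proof (intro iffI conjI ballI allI)
  assume \<pi>: "\<pi> \<in> transports"
  then show law: "\<pi> \<in> laws" by (simp add: measures_with_marginals_def)
  fix i q assume i: "i \<in> {1..d}"
  have "(\<integral>x. \<bar>x - q\<bar> \<partial>distr \<pi> (restrict_space borel (\<Omega> i)) (\<lambda>w. w i)) = (\<integral>w. \<bar>w i - q\<bar> \<partial>\<pi>)"
    using marginal_measurable[OF i, of \<Omega>]
    by (intro integral_distr) (auto simp: measurable_path[OF law] intro!: measurable_restrict_space1)
  then show "(\<integral>w. \<bar>w i - q\<bar> \<partial>\<pi>) = (\<integral>x. \<bar>x - q\<bar> \<partial>\<nu> i)"
    using \<pi> i by (simp add: measures_with_marginals_def del: One_nat_def)
next
  assume *: "\<pi> \<in> laws \<and> (\<forall>i\<in>{1..d}. \<forall>q. (\<integral>w. \<bar>w i - q\<bar> \<partial>\<pi>) = (\<integral>x. \<bar>x - q\<bar> \<partial>\<nu> i))"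
  then have law: "\<pi> \<in> laws" by simp
  have "distr \<pi> (restrict_space borel (\<Omega> i)) (\<lambda>w. w i) = \<nu> i" if i: "i \<in> {1..d}" for i
  proof (rule measure_eqI)
    have eq: "distr \<pi> borel (\<lambda>w. w i) = distr (\<nu> i) borel (\<lambda>x. x)"
      using * i
      by (intro distr_eq_if_hinges_eq lawsD[OF law] marginalD integrable_marginal_id
          integrable_path_continuous path_continuous_coord_id) auto
    have m: "(\<lambda>w. w i) \<in> \<pi> \<rightarrow>\<^sub>M restrict_space borel (\<Omega> i)"
      using marginal_measurable[OF i] by (simp add: measurable_path[OF law])
    have mb: "(\<lambda>w. w i) \<in> borel_measurable \<pi>"
      using measurable_coord[OF i] by (simp add: measurable_path[OF law])
    fix A assume "A \<in> sets (distr \<pi> (restrict_space borel (\<Omega> i)) (\<lambda>w. w i))"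
    then have A': "A \<in> sets (restrict_space borel (\<Omega> i))" by simp
    then have A: "A \<in> sets borel" "A \<subseteq> \<Omega> i"
      using box_eq[OF i] by (auto simp: sets_restrict_space_iff)
    have "emeasure (distr \<pi> (restrict_space borel (\<Omega> i)) (\<lambda>w. w i)) A = emeasure (distr \<pi> borel (\<lambda>w. w i)) A"
      using A A' m mb by (simp add: emeasure_distr)
    also have "\<dots> = emeasure (\<nu> i) A"
      unfolding eq using A marginalD(3,4)[OF i] by (simp add: emeasure_distr Int_absorb2)
    finally show "emeasure (distr \<pi> (restrict_space borel (\<Omega> i)) (\<lambda>w. w i)) A = emeasure (\<nu> i) A" .
  qed (simp add: marginalD[OF i])
  with law show "\<pi> \<in> transports"
    by (simp add: measures_with_marginals_def)
qed

text \<open>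
  Work in the cube over the largest interval. The resulting law lives on the box, because its
  marginals do, but on the larger sample space; clipping the coordinates moves it to the box
  without changing integrals.
\<close>

theorem strassen:
  assumes nested: "\<And>i. i \<in> {1..<d} \<Longrightarrow> \<Omega> i \<subseteq> \<Omega> (Suc i)"
    and order: "\<And>i. i \<in> {1..<d} \<Longrightarrow> convex_order (\<nu> i) (\<nu> (Suc i))"
  obtains \<pi> where "\<pi> \<in> martingales" "\<pi> \<in> transports"
proof -
  have d: "d \<in> {1..d}" using horizon by simp
  have subset: "\<Omega> i \<subseteq> {l d..u d}" if i: "i \<in> {1..d}" for i
  proof -
    have "i \<le> d" using i by simp
    then have "\<Omega> i \<subseteq> \<Omega> d"
      using i
    proof (induction rule: inc_induct)
      case (step k)
      then show ?case using nested[of k] by (force simp del: One_nat_def)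
    qed simp
    then show ?thesis using box_eq[OF d] by simp
  qed
  interpret C: cube d "l d" "u d"
    by standard (use box_nonempty[OF d] horizon in auto)
  have "space (\<nu> i) \<subseteq> {l d..u d}" if "i \<in> {1..d}" for i
    using subset[OF that] marginalD(3)[OF that] by simp
  then obtain \<rho> where \<rho>: "\<rho> \<in> C.martingales"
    and hinges: "\<And>i p. i \<in> {1..d} \<Longrightarrow> (\<integral>w. \<bar>w i - p\<bar> \<partial>\<rho>) = (\<integral>x. \<bar>x - p\<bar> \<partial>\<nu> i)"
    using C.martingale_with_hinges[of \<nu>] marginalD(1,4) order by blast
  note \<rho>_law = C.martingales_laws[OF \<rho>]
  interpret prob_space \<rho> by (rule C.lawsD(1)[OF \<rho>_law])
  have in_\<Omega>: "AE w in \<rho>. \<forall>i\<in>{1..d}. w i \<in> \<Omega> i"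
  proof (rule AE_finite_allI)
    fix i assume i: "i \<in> {1..d}"
    have "distr \<rho> borel (\<lambda>w. w i) = distr (\<nu> i) borel (\<lambda>x. x)"
      using i by (intro distr_eq_if_hinges_eq marginalD integrable_marginal_id prob_space_axioms hinges
          C.integrable_path_continuous path_continuous_coord_id \<rho>_law)
    moreover have "AE x in distr (\<nu> i) borel (\<lambda>x. x). x \<in> \<Omega> i"
      using marginalD(3,4)[OF i] box_eq[OF i] by (subst AE_distr_iff) auto
    ultimately have "AE x in distr \<rho> borel (\<lambda>w. w i). x \<in> \<Omega> i" by (simp only:)
    then show "AE w in \<rho>. w i \<in> \<Omega> i"
      using measurable_coord[OF i] box_eq[OF i]
      by (subst (asm) AE_distr_iff) (auto simp: C.measurable_path[OF \<rho>_law])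
  qed simp
  define clip where "clip w = (\<lambda>i\<in>{1..d}. max (l i) (min (u i) (w i)))" for w :: "nat \<Rightarrow> real"
  have clip: "clip \<in> \<rho> \<rightarrow>\<^sub>M path_space d \<Omega>"
    unfolding clip_def path_space_def
  proof (rule measurable_restrict)
    fix i assume i: "i \<in> {1..d}"
    have [measurable]: "(\<lambda>w. w i) \<in> borel_measurable \<rho>"
      using measurable_coord[OF i] by (simp add: C.measurable_path[OF \<rho>_law])
    show "(\<lambda>w. max (l i) (min (u i) (w i))) \<in> \<rho> \<rightarrow>\<^sub>M restrict_space borel (\<Omega> i)"
      using box_nonempty[OF i] box_eq[OF i] by (intro measurable_restrict_space2) auto
  qed
  define \<pi> where "\<pi> = distr \<rho> (path_space d \<Omega>) clip"
  have law: "\<pi> \<in> laws"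
    unfolding \<pi>_def using clip by (simp add: space_prob_algebra prob_space_distr)
  \<comment> \<open>clip fixes almost every path, and the martingale property and the marginals are integral conditions\<close>
  have same: "(\<integral>w. f w \<partial>\<pi>) = (\<integral>w. f w \<partial>\<rho>)" if f: "path_continuous d f" for f
  proof -
    have "(\<integral>w. f w \<partial>\<pi>) = (\<integral>w. f (clip w) \<partial>\<rho>)"
      unfolding \<pi>_def by (rule integral_distr[OF clip borel_measurable_path_continuous[OF f]])
    also have "\<dots> = (\<integral>w. f w \<partial>\<rho>)"
    proof (rule integral_cong_AE)
      show "(\<lambda>w. f (clip w)) \<in> borel_measurable \<rho>"
        by (rule measurable_compose[OF clip borel_measurable_path_continuous[OF f]])
      show "f \<in> borel_measurable \<rho>"
        using C.integrable_path_continuous[OF \<rho>_law f] by auto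
      show "AE w in \<rho>. f (clip w) = f w"
        using in_\<Omega> AE_space
      proof eventually_elim
        case (elim w)
        have "clip w i = w i" for i
        proof (cases "i \<in> {1..d}")
          case True
          then have "w i \<in> {l i..u i}" using elim(1) box_eq[OF True] by blast
          then show ?thesis using True by (simp add: clip_def)
        next
          case False
          then show ?thesis
            using elim(2) unfolding C.lawsD(3)[OF \<rho>_law]
            by (simp only: clip_def restrict_apply if_False PiE_arb[OF _ False])
        qed
        then have "clip w = w" by (rule ext)
        then show ?case by simp
      qed
    qed
    finally show ?thesis .
  qed
  have "\<pi> \<in> martingales"
    unfolding martingales_iff
  proof (intro conjI ballI allI impI law)
    fix k and \<phi> :: "nat \<Rightarrow> real \<Rightarrow> real"
    assume k: "k \<in> {1..<d}" and \<phi>: "\<forall>i. continuous_on UNIV (\<phi> i)"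
    have "path_continuous d (\<lambda>x. (x (Suc k) - x k) * (\<Prod>i\<in>{1..k}. \<phi> i (x i)))"
      using k \<phi> by (intro path_continuous_test) auto
    from same[OF this] show "(\<integral>x. (x (Suc k) - x k) * (\<Prod>i\<in>{1..k}. \<phi> i (x i)) \<partial>\<pi>) = 0"
      using \<rho> k \<phi> unfolding C.martingales_iff by simp
  qed
  moreover have "\<pi> \<in> transports"
    unfolding transports_iff using law same[OF path_continuous_hinge] hinges by simp
  ultimately show thesis by (rule that)
qed

end

section \<open>The relaxed problem\<close>

lemma mixture_couplings:
  assumes \<gamma>: "\<gamma> \<in> couplings \<mu> \<nu>" and \<gamma>': "\<gamma>' \<in> couplings \<mu>' \<nu>'"
    and \<mu>: "\<mu> \<in> space (prob_algebra M)" "\<mu>' \<in> space (prob_algebra M)"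
    and \<nu>: "\<nu> \<in> space (prob_algebra N)" "\<nu>' \<in> space (prob_algebra N)"
    and t: "0 \<le> t" "t \<le> 1"
  shows "mixture t \<gamma> \<gamma>' \<in> couplings (mixture t \<mu> \<mu>') (mixture t \<nu> \<nu>')"
proof -
  have sets: "sets \<mu> = sets M" "sets \<mu>' = sets M" "sets \<nu> = sets N" "sets \<nu>' = sets N"
    using \<mu> \<nu> by (auto simp: space_prob_algebra)
  have sets_mix: "sets (mixture t \<mu> \<mu>') = sets M" "sets (mixture t \<nu> \<nu>') = sets N"
    using mixture_in_prob_algebra[OF \<mu> t] mixture_in_prob_algebra[OF \<nu> t] by (auto simp: space_prob_algebra)
  have pa: "\<gamma> \<in> space (prob_algebra (M \<Otimes>\<^sub>M N))" "\<gamma>' \<in> space (prob_algebra (M \<Otimes>\<^sub>M N))"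
    using \<gamma> \<gamma>' sets_pair_measure_cong[OF sets(1,3)] sets_pair_measure_cong[OF sets(2,4)]
    by (auto simp: couplings_def space_prob_algebra)
  have "distr \<gamma> M fst = \<mu>" "distr \<gamma>' M fst = \<mu>'" "distr \<gamma> N snd = \<nu>" "distr \<gamma>' N snd = \<nu>'"
    using \<gamma> \<gamma>' sets distr_cong[OF refl, of M \<mu> \<gamma> fst fst] distr_cong[OF refl, of M \<mu>' \<gamma>' fst fst]
      distr_cong[OF refl, of N \<nu> \<gamma> snd snd] distr_cong[OF refl, of N \<nu>' \<gamma>' snd snd]
    by (simp_all add: couplings_def)
  then have "distr (mixture t \<gamma> \<gamma>') M fst = mixture t \<mu> \<mu>'" "distr (mixture t \<gamma> \<gamma>') N snd = mixture t \<nu> \<nu>'"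
    by (simp_all add: distr_mixture[OF pa t measurable_fst] distr_mixture[OF pa t measurable_snd])
  then have "distr (mixture t \<gamma> \<gamma>') (mixture t \<mu> \<mu>') fst = mixture t \<mu> \<mu>'"
    "distr (mixture t \<gamma> \<gamma>') (mixture t \<nu> \<nu>') snd = mixture t \<nu> \<nu>'"
    using sets_mix distr_cong[OF refl, of M "mixture t \<mu> \<mu>'" "mixture t \<gamma> \<gamma>'" fst fst]
      distr_cong[OF refl, of N "mixture t \<nu> \<nu>'" "mixture t \<gamma> \<gamma>'" snd snd] by simp_all
  moreover have "mixture t \<gamma> \<gamma>' \<in> space (prob_algebra (mixture t \<mu> \<mu>' \<Otimes>\<^sub>M mixture t \<nu> \<nu>'))"
    using mixture_in_prob_algebra[OF pa t] sets_pair_measure_cong[OF sets_mix]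
    by (simp add: space_prob_algebra)
  ultimately show ?thesis by (simp add: couplings_def)
qed

lemma diagonal_coupling:
  assumes "prob_space \<mu>"
  shows "distr \<mu> (\<mu> \<Otimes>\<^sub>M \<mu>) (\<lambda>x. (x, x)) \<in> couplings \<mu> \<mu>"
proof -
  interpret prob_space \<mu> by fact
  have "distr (distr \<mu> (\<mu> \<Otimes>\<^sub>M \<mu>) (\<lambda>x. (x, x))) \<mu> fst = \<mu>" "distr (distr \<mu> (\<mu> \<Otimes>\<^sub>M \<mu>) (\<lambda>x. (x, x))) \<mu> snd = \<mu>"
    by (simp_all add: distr_distr o_def)
  then show ?thesis
    by (auto simp: couplings_def space_prob_algebra intro!: prob_space_distr)
qed

context box_marginals
begin

abbreviation "relaxed \<equiv> relaxed_martingale_measures d \<Omega> \<nu>"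
abbreviation "distance x y \<equiv> (\<Sum>i=1..d. \<bar>x i - y i\<bar>)"

lemma measurable_distance: "(\<lambda>(x, y). ennreal (distance x y)) \<in> borel_measurable (path_space d \<Omega> \<Otimes>\<^sub>M path_space d \<Omega>)"
proof -
  have "(\<lambda>z. fst z i) \<in> borel_measurable (path_space d \<Omega> \<Otimes>\<^sub>M path_space d \<Omega>)"
       "(\<lambda>z. snd z i) \<in> borel_measurable (path_space d \<Omega> \<Otimes>\<^sub>M path_space d \<Omega>)" if "i \<in> {1..d}" for i
    using measurable_coord[OF that] by (auto intro: measurable_compose[OF measurable_fst] measurable_compose[OF measurable_snd])
  then have "(\<lambda>z. ennreal (\<Sum>i=1..d. \<bar>fst z i - snd z i\<bar>)) \<in> borel_measurable (path_space d \<Omega> \<Otimes>\<^sub>M path_space d \<Omega>)"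
    by (intro measurable_compose[OF _ measurable_ennreal] borel_measurable_sum borel_measurable_abs borel_measurable_diff)
  then show ?thesis by (simp add: case_prod_beta)
qed

lemma transports_laws: "\<pi> \<in> transports \<Longrightarrow> \<pi> \<in> laws"
  by (simp add: transports_iff)

lemma relaxed_martingale: "\<pi> \<in> relaxed \<epsilon> \<Longrightarrow> \<pi> \<in> martingales"
  by (simp add: relaxed_martingale_measures_def)

lemma relaxed_mono: "\<epsilon> \<le> \<epsilon>' \<Longrightarrow> relaxed \<epsilon> \<subseteq> relaxed \<epsilon>'"
  unfolding relaxed_martingale_measures_def by (auto intro: order_trans ennreal_leI)

text \<open>
  The two infima in the definition of the distance to the set of laws with the given marginals are
  unfolded once, into near optimal couplings up to an arbitrary slack.
\<close>

lemma relaxedE: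
  assumes \<pi>: "\<pi> \<in> relaxed \<epsilon>" and "0 \<le> \<epsilon>" "0 < \<eta>"
  obtains \<pi>' \<gamma> where "\<pi>' \<in> transports" "\<gamma> \<in> couplings \<pi> \<pi>'"
    "(\<integral>\<^sup>+ (x, y). ennreal (distance x y) \<partial>\<gamma>) \<le> ennreal (\<epsilon> + \<eta>)"
proof -
  have "wasserstein_to_set d \<pi> transports \<le> ennreal \<epsilon>"
    using \<pi> by (simp add: relaxed_martingale_measures_def)
  also have "\<dots> < ennreal (\<epsilon> + \<eta>)"
    using assms by (simp add: ennreal_less_iff)
  finally obtain \<pi>' where \<pi>': "\<pi>' \<in> transports" "wasserstein d \<pi> \<pi>' < ennreal (\<epsilon> + \<eta>)"
    unfolding wasserstein_to_set_def INF_less_iff by blast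
  then obtain \<gamma> where "\<gamma> \<in> couplings \<pi> \<pi>'" "(\<integral>\<^sup>+ (x, y). ennreal (distance x y) \<partial>\<gamma>) < ennreal (\<epsilon> + \<eta>)"
    unfolding wasserstein_def INF_less_iff by blast
  with \<pi>'(1) show thesis by (intro that) auto
qed

lemma relaxedI:
  assumes \<pi>: "\<pi> \<in> martingales" and "0 \<le> \<epsilon>"
    and near: "\<And>\<eta>. 0 < \<eta> \<Longrightarrow> \<exists>\<pi>'\<in>transports. \<exists>\<gamma>\<in>couplings \<pi> \<pi>'.
      (\<integral>\<^sup>+ (x, y). ennreal (distance x y) \<partial>\<gamma>) \<le> ennreal (\<epsilon> + \<eta>)"
  shows "\<pi> \<in> relaxed \<epsilon>"
proof -
  have "wasserstein_to_set d \<pi> transports \<le> ennreal \<epsilon>"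
  proof (rule ennreal_le_epsilon)
    fix \<eta> :: real assume "0 < \<eta>"
    from near[OF this] obtain \<pi>' \<gamma> where "\<pi>' \<in> transports" "\<gamma> \<in> couplings \<pi> \<pi>'"
      "(\<integral>\<^sup>+ (x, y). ennreal (distance x y) \<partial>\<gamma>) \<le> ennreal (\<epsilon> + \<eta>)" by blast
    then have "wasserstein_to_set d \<pi> transports \<le> ennreal (\<epsilon> + \<eta>)"
      unfolding wasserstein_to_set_def wasserstein_def by (blast intro: INF_lower2)
    then show "wasserstein_to_set d \<pi> transports \<le> ennreal \<epsilon> + ennreal \<eta>"
      using \<open>0 < \<eta>\<close> \<open>0 \<le> \<epsilon>\<close> by simp
  qed
  then show ?thesis using \<pi> by (simp add: relaxed_martingale_measures_def)
qed

lemma mixture_transports: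
  assumes "\<pi> \<in> transports" "\<rho> \<in> transports" "0 \<le> t" "t \<le> 1"
  shows "mixture t \<pi> \<rho> \<in> transports"
proof -
  note laws = transports_laws[OF assms(1)] transports_laws[OF assms(2)]
  have "(\<integral>w. \<bar>w i - q\<bar> \<partial>mixture t \<pi> \<rho>) = (\<integral>x. \<bar>x - q\<bar> \<partial>\<nu> i)" if i: "i \<in> {1..d}" for i q
  proof -
    have "(\<integral>w. \<bar>w i - q\<bar> \<partial>\<pi>) = (\<integral>x. \<bar>x - q\<bar> \<partial>\<nu> i)" "(\<integral>w. \<bar>w i - q\<bar> \<partial>\<rho>) = (\<integral>x. \<bar>x - q\<bar> \<partial>\<nu> i)"
      using assms(1,2) i unfolding transports_iff by blast+
    then show ?thesis
      unfolding integral_mixture_path[OF laws assms(3,4) path_continuous_hinge[OF i]] by (simp add: algebra_simps)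
  qed
  then show ?thesis
    unfolding transports_iff using mixture_in_prob_algebra[OF laws assms(3,4)] by blast
qed

lemma mixture_relaxed:
  assumes \<pi>: "\<pi> \<in> relaxed \<epsilon>" and \<rho>: "\<rho> \<in> relaxed \<delta>" and nonneg: "0 \<le> \<epsilon>" "0 \<le> \<delta>" and t: "0 \<le> t" "t \<le> 1"
  shows "mixture t \<pi> \<rho> \<in> relaxed (t * \<epsilon> + (1 - t) * \<delta>)"
proof (rule relaxedI)
  note laws = martingales_laws[OF relaxed_martingale[OF \<pi>]] martingales_laws[OF relaxed_martingale[OF \<rho>]]
  show "mixture t \<pi> \<rho> \<in> martingales"
    by (intro mixture_martingales relaxed_martingale[OF \<pi>] relaxed_martingale[OF \<rho>] t)
  show "0 \<le> t * \<epsilon> + (1 - t) * \<delta>" using nonneg t by simp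
  fix \<eta> :: real assume \<eta>: "0 < \<eta>"
  obtain \<pi>' \<gamma> where \<pi>': "\<pi>' \<in> transports" "\<gamma> \<in> couplings \<pi> \<pi>'"
    "(\<integral>\<^sup>+ (x, y). ennreal (distance x y) \<partial>\<gamma>) \<le> ennreal (\<epsilon> + \<eta>)" using relaxedE[OF \<pi> nonneg(1) \<eta>] .
  obtain \<rho>' \<kappa> where \<rho>': "\<rho>' \<in> transports" "\<kappa> \<in> couplings \<rho> \<rho>'"
    "(\<integral>\<^sup>+ (x, y). ennreal (distance x y) \<partial>\<kappa>) \<le> ennreal (\<delta> + \<eta>)" using relaxedE[OF \<rho> nonneg(2) \<eta>] .
  note laws' = transports_laws[OF \<pi>'(1)] transports_laws[OF \<rho>'(1)]
  have pa: "\<gamma> \<in> space (prob_algebra (path_space d \<Omega> \<Otimes>\<^sub>M path_space d \<Omega>))"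
    "\<kappa> \<in> space (prob_algebra (path_space d \<Omega> \<Otimes>\<^sub>M path_space d \<Omega>))"
    using \<pi>'(2) \<rho>'(2) sets_pair_measure_cong[OF lawsD(2)[OF laws(1)] lawsD(2)[OF laws'(1)]]
      sets_pair_measure_cong[OF lawsD(2)[OF laws(2)] lawsD(2)[OF laws'(2)]]
    by (auto simp: couplings_def space_prob_algebra)
  have "(\<integral>\<^sup>+ (x, y). ennreal (distance x y) \<partial>mixture t \<gamma> \<kappa>)
      \<le> ennreal t * ennreal (\<epsilon> + \<eta>) + ennreal (1 - t) * ennreal (\<delta> + \<eta>)"
    unfolding nn_integral_mixture[OF pa t measurable_distance]
    by (intro add_mono mult_left_mono \<pi>' \<rho>') auto
  also have "\<dots> = ennreal (t * (\<epsilon> + \<eta>) + (1 - t) * (\<delta> + \<eta>))"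
    using t nonneg \<eta> by (simp add: ennreal_mult ennreal_plus)
  also have "t * (\<epsilon> + \<eta>) + (1 - t) * (\<delta> + \<eta>) = t * \<epsilon> + (1 - t) * \<delta> + \<eta>"
    by (simp add: algebra_simps)
  finally show "\<exists>\<pi>''\<in>transports. \<exists>\<gamma>'\<in>couplings (mixture t \<pi> \<rho>) \<pi>''.
      (\<integral>\<^sup>+ (x, y). ennreal (distance x y) \<partial>\<gamma>') \<le> ennreal (t * \<epsilon> + (1 - t) * \<delta> + \<eta>)"
    using mixture_transports[OF \<pi>'(1) \<rho>'(1) t] mixture_couplings[OF \<pi>'(2) \<rho>'(2) laws laws' t] by blast
qed

text \<open>A hinge of a single coordinate is 1-Lipschitz for the transport cost.\<close>

lemma relaxed_hinge:
  assumes \<pi>: "\<pi> \<in> relaxed \<epsilon>" and \<epsilon>: "0 \<le> \<epsilon>" and i: "i \<in> {1..d}"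
  shows "\<bar>(\<integral>w. \<bar>w i - q\<bar> \<partial>\<pi>) - (\<integral>x. \<bar>x - q\<bar> \<partial>\<nu> i)\<bar> \<le> \<epsilon>"
proof (rule field_le_epsilon)
  fix \<eta> :: real assume \<eta>: "0 < \<eta>"
  obtain \<pi>' \<gamma> where \<pi>': "\<pi>' \<in> transports" "\<gamma> \<in> couplings \<pi> \<pi>'"
    and le: "(\<integral>\<^sup>+ (x, y). ennreal (distance x y) \<partial>\<gamma>) \<le> ennreal (\<epsilon> + \<eta>)" using relaxedE[OF \<pi> \<epsilon> \<eta>] .
  note law = martingales_laws[OF relaxed_martingale[OF \<pi>]]
  note law' = transports_laws[OF \<pi>'(1)]
  have sets_\<gamma>: "sets \<gamma> = sets (\<pi> \<Otimes>\<^sub>M \<pi>')" and prob: "prob_space \<gamma>"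
    and fst: "distr \<gamma> \<pi> fst = \<pi>" and snd: "distr \<gamma> \<pi>' snd = \<pi>'"
    using \<pi>'(2) by (auto simp: couplings_def space_prob_algebra)
  interpret prob_space \<gamma> by (rule prob)
  define f where "f w = \<bar>w i - q\<bar>" for w :: "nat \<Rightarrow> real"
  have f: "path_continuous d f" unfolding f_def by (rule path_continuous_hinge[OF i])
  have m: "fst \<in> \<gamma> \<rightarrow>\<^sub>M \<pi>" "snd \<in> \<gamma> \<rightarrow>\<^sub>M \<pi>'"
    unfolding measurable_cong_sets[OF sets_\<gamma> refl] by auto
  have fm: "f \<in> borel_measurable \<pi>" "f \<in> borel_measurable \<pi>'"
    using integrable_path_continuous[OF law f] integrable_path_continuous[OF law' f] by auto
  have int: "integrable \<gamma> (\<lambda>z. f (fst z))" "integrable \<gamma> (\<lambda>z. f (snd z))"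
    using integrable_path_continuous[OF law f] integrable_path_continuous[OF law' f]
      integrable_distr_eq[OF m(1) fm(1)] integrable_distr_eq[OF m(2) fm(2)] unfolding fst snd by auto
  have "(\<integral>w. f w \<partial>\<pi>) = (\<integral>z. f (fst z) \<partial>\<gamma>)" "(\<integral>w. f w \<partial>\<pi>') = (\<integral>z. f (snd z) \<partial>\<gamma>)"
    using integral_distr[OF m(1) fm(1)] integral_distr[OF m(2) fm(2)] unfolding fst snd by auto
  moreover have "(\<integral>w. f w \<partial>\<pi>') = (\<integral>x. \<bar>x - q\<bar> \<partial>\<nu> i)"
    using \<pi>'(1) i unfolding transports_iff f_def by blast
  ultimately have "\<bar>(\<integral>w. f w \<partial>\<pi>) - (\<integral>x. \<bar>x - q\<bar> \<partial>\<nu> i)\<bar> = \<bar>\<integral>z. f (fst z) - f (snd z) \<partial>\<gamma>\<bar>"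
    using int by simp
  also have "\<dots> \<le> (\<integral>z. \<bar>f (fst z) - f (snd z)\<bar> \<partial>\<gamma>)"
    by (rule integral_abs_bound)
  also have "\<dots> \<le> \<epsilon> + \<eta>"
  proof -
    have "ennreal (\<integral>z. \<bar>f (fst z) - f (snd z)\<bar> \<partial>\<gamma>) = (\<integral>\<^sup>+z. ennreal \<bar>f (fst z) - f (snd z)\<bar> \<partial>\<gamma>)"
      using int by (intro nn_integral_eq_integral[symmetric]) auto
    also have "\<dots> \<le> (\<integral>\<^sup>+ (x, y). ennreal (distance x y) \<partial>\<gamma>)"
    proof (rule nn_integral_mono)
      fix z
      have "\<bar>f (fst z) - f (snd z)\<bar> \<le> \<bar>fst z i - snd z i\<bar>" by (simp add: f_def)
      also have "\<dots> \<le> distance (fst z) (snd z)"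
        using i by (intro member_le_sum[where f="\<lambda>i. \<bar>fst z i - snd z i\<bar>"]) auto
      finally show "ennreal \<bar>f (fst z) - f (snd z)\<bar> \<le> (case z of (x, y) \<Rightarrow> ennreal (distance x y))"
        by (simp add: case_prod_beta ennreal_leI)
    qed
    finally show ?thesis
      using le \<epsilon> \<eta> by (meson add_nonneg_nonneg ennreal_le_iff less_imp_le order_trans)
  qed
  finally show "\<bar>(\<integral>w. \<bar>w i - q\<bar> \<partial>\<pi>) - (\<integral>x. \<bar>x - q\<bar> \<partial>\<nu> i)\<bar> \<le> \<epsilon> + \<eta>"
    unfolding f_def .
qed

lemma relaxed_zeroI:
  assumes \<pi>: "\<pi> \<in> martingales" "\<pi> \<in> transports"
  shows "\<pi> \<in> relaxed 0"
proof (rule relaxedI[OF \<pi>(1)])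
  note law = transports_laws[OF \<pi>(2)]
  fix \<eta> :: real assume "0 < \<eta>"
  define \<gamma> where "\<gamma> = distr \<pi> (\<pi> \<Otimes>\<^sub>M \<pi>) (\<lambda>x. (x, x))"
  have sets: "sets (\<pi> \<Otimes>\<^sub>M \<pi>) = sets (path_space d \<Omega> \<Otimes>\<^sub>M path_space d \<Omega>)"
    by (intro sets_pair_measure_cong lawsD(2)[OF law])
  have "(\<integral>\<^sup>+ (x, y). ennreal (distance x y) \<partial>\<gamma>) = (\<integral>\<^sup>+ x. ennreal (distance x x) \<partial>\<pi>)"
    unfolding \<gamma>_def using measurable_distance
    by (subst nn_integral_distr) (simp_all add: measurable_cong_sets[OF sets refl])
  then have "(\<integral>\<^sup>+ (x, y). ennreal (distance x y) \<partial>\<gamma>) \<le> ennreal (0 + \<eta>)" by simp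
  then show "\<exists>\<pi>'\<in>transports. \<exists>\<gamma>\<in>couplings \<pi> \<pi>'. (\<integral>\<^sup>+ (x, y). ennreal (distance x y) \<partial>\<gamma>) \<le> ennreal (0 + \<eta>)"
    using diagonal_coupling[OF lawsD(1)[OF law]] \<pi>(2) unfolding \<gamma>_def by blast
qed simp

text \<open>
  Weak limits keep the martingale property, and the hinge integrals of the marginals converge to
  those of \<nu>, which pins the marginals of the limit.
\<close>

lemma relaxed_limit:
  assumes \<pi>: "\<And>n. \<pi> n \<in> relaxed (\<epsilon> n)" and \<epsilon>: "\<And>n. 0 \<le> \<epsilon> n" "\<epsilon> \<longlonglongrightarrow> 0"
  obtains r :: "nat \<Rightarrow> nat" and \<rho> where "strict_mono r" "\<rho> \<in> relaxed 0"
    "\<And>f. path_continuous d f \<Longrightarrow> (\<lambda>n. \<integral>x. f x \<partial>\<pi> (r n)) \<longlonglongrightarrow> (\<integral>x. f x \<partial>\<rho>)"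
proof -
  obtain r :: "nat \<Rightarrow> nat" and \<rho> where r: "strict_mono r" and \<rho>: "\<rho> \<in> martingales"
    and lim: "\<And>f. path_continuous d f \<Longrightarrow> (\<lambda>n. \<integral>x. f x \<partial>\<pi> (r n)) \<longlonglongrightarrow> (\<integral>x. f x \<partial>\<rho>)"
    using martingales_sequentially_compact[of \<pi>] relaxed_martingale[OF \<pi>] by blast
  have "(\<integral>w. \<bar>w i - q\<bar> \<partial>\<rho>) = (\<integral>x. \<bar>x - q\<bar> \<partial>\<nu> i)" if i: "i \<in> {1..d}" for i q
  proof -
    have "(\<lambda>n. (\<integral>w. \<bar>w i - q\<bar> \<partial>\<pi> (r n)) - (\<integral>x. \<bar>x - q\<bar> \<partial>\<nu> i)) \<longlonglongrightarrow> 0"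
    proof (rule tendsto_rabs_zero_cancel, rule tendsto_sandwich[of "\<lambda>_. 0" _ _ "\<lambda>n. \<epsilon> (r n)"])
      show "\<forall>\<^sub>F n in sequentially. \<bar>(\<integral>w. \<bar>w i - q\<bar> \<partial>\<pi> (r n)) - (\<integral>x. \<bar>x - q\<bar> \<partial>\<nu> i)\<bar> \<le> \<epsilon> (r n)"
        by (intro always_eventually allI relaxed_hinge \<pi> \<epsilon> i)
      show "(\<lambda>n. \<epsilon> (r n)) \<longlonglongrightarrow> 0"
        using LIMSEQ_subseq_LIMSEQ[OF \<epsilon>(2) r] by (simp add: o_def)
    qed (auto intro: always_eventually)
    then have "(\<lambda>n. \<integral>w. \<bar>w i - q\<bar> \<partial>\<pi> (r n)) \<longlonglongrightarrow> (\<integral>x. \<bar>x - q\<bar> \<partial>\<nu> i)"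
      by (rule LIM_zero_cancel)
    then show ?thesis
      by (rule LIMSEQ_unique[OF lim[OF path_continuous_hinge[OF i]]])
  qed
  then have "\<rho> \<in> transports"
    unfolding transports_iff using martingales_laws[OF \<rho>] by blast
  then show thesis using that[OF r relaxed_zeroI[OF \<rho>] lim] by blast
qed

context
  fixes f :: "(nat \<Rightarrow> real) \<Rightarrow> real"
  assumes f: "path_continuous d f"
begin

abbreviation "best_value \<equiv> relaxed_value d \<Omega> \<nu> f"

lemma value_bdd_above: "bdd_above ((\<lambda>\<pi>. \<integral>x. f x \<partial>\<pi>) ` relaxed \<epsilon>)"
proof -
  obtain C where "\<And>\<pi>. \<pi> \<in> laws \<Longrightarrow> \<bar>\<integral>w. f w \<partial>\<pi>\<bar> \<le> C"
    using path_continuous_expectation_bounded[OF f] by blast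
  then show ?thesis
    by (intro bdd_aboveI2[where M=C]) (blast intro: abs_le_D1 martingales_laws relaxed_martingale)
qed

lemma value_ge: "\<pi> \<in> relaxed \<epsilon> \<Longrightarrow> (\<integral>x. f x \<partial>\<pi>) \<le> best_value \<epsilon>"
  unfolding relaxed_value_def by (rule cSUP_upper[OF _ value_bdd_above])

lemma value_approx:
  assumes "relaxed \<epsilon> \<noteq> {}" "c < best_value \<epsilon>"
  obtains \<pi> where "\<pi> \<in> relaxed \<epsilon>" "c < (\<integral>x. f x \<partial>\<pi>)"
  using assms unfolding relaxed_value_def less_cSUP_iff[OF assms(1) value_bdd_above] by blast

lemma value_mono: "relaxed \<epsilon> \<noteq> {} \<Longrightarrow> \<epsilon> \<le> \<delta> \<Longrightarrow> best_value \<epsilon> \<le> best_value \<delta>"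
  unfolding relaxed_value_def by (intro cSUP_subset_mono value_bdd_above relaxed_mono) auto

lemma value_mixture:
  assumes ne: "relaxed \<epsilon> \<noteq> {}" "relaxed \<delta> \<noteq> {}" and nonneg: "0 \<le> \<epsilon>" "0 \<le> \<delta>" and t: "0 \<le> t" "t \<le> 1"
  shows "t * best_value \<epsilon> + (1 - t) * best_value \<delta> \<le> best_value (t * \<epsilon> + (1 - t) * \<delta>)"
proof (rule field_le_epsilon)
  fix e :: real assume "0 < e"
  obtain \<pi> where \<pi>: "\<pi> \<in> relaxed \<epsilon>" "best_value \<epsilon> - e < (\<integral>x. f x \<partial>\<pi>)"
    using value_approx[OF ne(1), of "best_value \<epsilon> - e"] \<open>0 < e\<close> by auto
  obtain \<rho> where \<rho>: "\<rho> \<in> relaxed \<delta>" "best_value \<delta> - e < (\<integral>x. f x \<partial>\<rho>)"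
    using value_approx[OF ne(2), of "best_value \<delta> - e"] \<open>0 < e\<close> by auto
  have "t * (best_value \<epsilon> - e) + (1 - t) * (best_value \<delta> - e) \<le> t * (\<integral>x. f x \<partial>\<pi>) + (1 - t) * (\<integral>x. f x \<partial>\<rho>)"
    using \<pi>(2) \<rho>(2) t by (intro add_mono mult_left_mono) auto
  also have "\<dots> = (\<integral>x. f x \<partial>mixture t \<pi> \<rho>)"
    using integral_mixture_path[OF _ _ t f, of \<pi> \<rho>] martingales_laws relaxed_martingale \<pi>(1) \<rho>(1) by simp
  also have "\<dots> \<le> best_value (t * \<epsilon> + (1 - t) * \<delta>)"
    by (intro value_ge mixture_relaxed \<pi> \<rho> nonneg t)
  finally show "t * best_value \<epsilon> + (1 - t) * best_value \<delta> \<le> best_value (t * \<epsilon> + (1 - t) * \<delta>) + e"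
    by (simp add: algebra_simps)
qed

text \<open>
  Above the critical radius the feasible sets are nonempty by monotonicity. If they were all empty,
  the value function would be constant.
\<close>

lemma concave_value: "concave_on {critical_radius d \<Omega> \<nu><..} best_value"
proof (cases "\<exists>\<epsilon>\<ge>0. relaxed \<epsilon> \<noteq> {}")
  case False
  have "relaxed \<epsilon> = {}" for \<epsilon>
    using False relaxed_mono[of \<epsilon> "max 0 \<epsilon>"] max.cobounded1[of 0 \<epsilon>] by auto
  then have "best_value = (\<lambda>_. Sup {})" by (auto simp: relaxed_value_def fun_eq_iff)
  then show ?thesis by (simp add: concave_on_def convex_on_const)
next
  case True
  define S where "S = {\<epsilon>. 0 \<le> \<epsilon> \<and> relaxed \<epsilon> \<noteq> {}}"
  have S: "S \<noteq> {}" using True unfolding S_def by blast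
  have above: "0 \<le> \<epsilon> \<and> relaxed \<epsilon> \<noteq> {}" if "critical_radius d \<Omega> \<nu> < \<epsilon>" for \<epsilon>
  proof -
    have "Inf S < \<epsilon>"
      using that by (simp only: critical_radius_def S_def)
    then obtain \<delta> where \<delta>: "0 \<le> \<delta>" "relaxed \<delta> \<noteq> {}" "\<delta> < \<epsilon>"
      using cInf_lessD[OF S] unfolding S_def by blast
    then show ?thesis using relaxed_mono[of \<delta> \<epsilon>] by auto
  qed
  show ?thesis
    unfolding concave_on_def
  proof (rule convex_onI)
    fix t x y :: real
    assume t: "0 < t" "t < 1" and x: "x \<in> {critical_radius d \<Omega> \<nu><..}" and y: "y \<in> {critical_radius d \<Omega> \<nu><..}"
    show "- best_value ((1 - t) *\<^sub>R x + t *\<^sub>R y) \<le> (1 - t) * - best_value x + t * - best_value y"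
    proof -
      have "0 \<le> x" "relaxed x \<noteq> {}" "0 \<le> y" "relaxed y \<noteq> {}"
        using above x y by blast+
      then have "(1 - t) * best_value x + (1 - (1 - t)) * best_value y \<le> best_value ((1 - t) * x + (1 - (1 - t)) * y)"
        using t by (intro value_mixture) auto
      then show ?thesis by simp
    qed
  qed simp
qed

lemma continuous_value: "continuous_on {critical_radius d \<Omega> \<nu><..} best_value"
  using continuous_on_minus[OF convex_on_continuous[OF open_greaterThan concave_value[unfolded concave_on_def]]]
  by simp

lemma value_right_continuous_at_zero:
  assumes ne: "relaxed 0 \<noteq> {}" and e: "0 < e"
  obtains \<delta> where "0 < \<delta>" "best_value \<delta> < best_value 0 + e"
proof -
  \<comment> \<open>otherwise near optimal laws at the radii 1/n would converge to a law that beats the value at 0\<close>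
  have "\<exists>n. best_value (1 / real (Suc n)) < best_value 0 + e"
  proof (rule ccontr)
    assume "\<not> ?thesis"
    then have ge: "best_value 0 + e / 2 < best_value (1 / real (Suc n))" for n
      using e by (auto simp: not_less intro: less_le_trans[of _ "best_value 0 + e"])
    have "relaxed (1 / real (Suc n)) \<noteq> {}" for n
      using ne relaxed_mono[of 0 "1 / real (Suc n)"] by auto
    then have "\<exists>\<pi>\<in>relaxed (1 / real (Suc n)). best_value 0 + e / 2 < (\<integral>x. f x \<partial>\<pi>)" for n
      using value_approx[OF _ ge[of n]] by blast
    then obtain \<pi> where \<pi>: "\<And>n. \<pi> n \<in> relaxed (1 / real (Suc n))" "\<And>n. best_value 0 + e / 2 < (\<integral>x. f x \<partial>\<pi> n)"
      by metis
    have nonneg: "0 \<le> 1 / real (Suc n)" for n by simp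
    have to_0: "(\<lambda>n. 1 / real (Suc n)) \<longlonglongrightarrow> 0"
      using LIMSEQ_inverse_real_of_nat by (simp add: inverse_eq_divide)
    obtain r :: "nat \<Rightarrow> nat" and \<rho> where \<rho>: "\<rho> \<in> relaxed 0"
      and lim: "\<And>f. path_continuous d f \<Longrightarrow> (\<lambda>n. \<integral>x. f x \<partial>\<pi> (r n)) \<longlonglongrightarrow> (\<integral>x. f x \<partial>\<rho>)"
      using relaxed_limit[OF \<pi>(1) nonneg to_0] by blast
    have "best_value 0 + e / 2 \<le> (\<integral>x. f x \<partial>\<rho>)"
      by (rule LIMSEQ_le_const[OF lim[OF f]]) (use \<pi>(2) in \<open>auto intro: less_imp_le\<close>)
    then show False using value_ge[OF \<rho>] e by simp
  qed
  then obtain n where "best_value (1 / real (Suc n)) < best_value 0 + e" by blast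
  moreover have "0 < 1 / real (Suc n)" by simp
  ultimately show thesis by (rule that[rotated])
qed

lemma continuous_value_from_zero:
  assumes ne: "relaxed 0 \<noteq> {}"
  shows "continuous_on {0..} best_value"
proof -
  have "critical_radius d \<Omega> \<nu> \<le> 0"
    unfolding critical_radius_def using ne by (intro cInf_lower bdd_belowI[of _ 0]) auto
  then have pos: "continuous_on {0<..} best_value"
    by (intro continuous_on_subset[OF continuous_value]) auto
  have "continuous (at x within {0..}) best_value" if "0 \<le> x" for x
  proof (cases "x = 0")
    case False
    then have "isCont best_value x"
      using pos that by (simp add: continuous_on_eq_continuous_at)
    then show ?thesis by (rule continuous_at_imp_continuous_at_within)
  next
    case True
    have "\<exists>\<delta>>0. \<forall>x'\<in>{0..}. dist x' 0 < \<delta> \<longrightarrow> dist (best_value x') (best_value 0) < e" if e: "0 < e" for e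
    proof -
      obtain \<delta> where \<delta>: "0 < \<delta>" "best_value \<delta> < best_value 0 + e"
        using value_right_continuous_at_zero[OF ne e] .
      have "dist (best_value x') (best_value 0) < e" if "0 \<le> x'" "x' < \<delta>" for x'
      proof -
        have "relaxed x' \<noteq> {}" using ne relaxed_mono[OF that(1)] by auto
        then have "best_value 0 \<le> best_value x'" "best_value x' \<le> best_value \<delta>"
          using that ne by (auto intro!: value_mono)
        then show ?thesis using \<delta> by (simp add: dist_real_def)
      qed
      then show ?thesis using \<delta>(1) by (auto simp: dist_real_def)
    qed
    then show ?thesis
      unfolding True continuous_within_eps_delta by blast
  qed
  then show ?thesis
    by (simp add: continuous_on_eq_continuous_within)
qed

end
end

theorem proposition1:
  fixes d :: nat
    and \<Omega> :: "nat \<Rightarrow> real set"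
    and \<nu> :: "nat \<Rightarrow> real measure"
    and f :: "(nat \<Rightarrow> real) \<Rightarrow> real"
  assumes "1 \<le> d"
    and "\<And>i. i \<in> {1..d} \<Longrightarrow> is_interval (\<Omega> i)"
    and "\<And>i. i \<in> {1..d} \<Longrightarrow> compact (\<Omega> i)"
    and "\<And>i. i \<in> {1..<d} \<Longrightarrow> \<Omega> i \<subseteq> \<Omega> (Suc i)"
    and "continuous_map (product_topology (\<lambda>_. euclideanreal) {1..d}) euclideanreal f"
    and "\<And>i. i \<in> {1..d} \<Longrightarrow> \<nu> i \<in> space (prob_algebra (restrict_space borel (\<Omega> i)))"
  shows "concave_on {critical_radius d \<Omega> \<nu><..} (relaxed_value d \<Omega> \<nu> f)
    \<and> continuous_on {critical_radius d \<Omega> \<nu><..} (relaxed_value d \<Omega> \<nu> f)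
    \<and> ((\<forall>i\<in>{1..<d}. convex_order (\<nu> i) (\<nu> (Suc i)))
        \<longrightarrow> continuous_on {0..} (relaxed_value d \<Omega> \<nu> f))"
proof -
  have "\<exists>a b. \<Omega> i = {a..b} \<and> a \<le> b" if i: "i \<in> {1..d}" for i
  proof -
    obtain a b where ab: "\<Omega> i = {a..b}"
      using connected_compact_interval_1[of "\<Omega> i"] assms(2,3)[OF i] is_interval_connected_1 by blast
    have "prob_space (\<nu> i)" and sets: "sets (\<nu> i) = sets (restrict_space borel (\<Omega> i))"
      using assms(6)[OF i] by (auto simp: space_prob_algebra)
    then have "\<Omega> i \<noteq> {}"
      using prob_space.not_empty[of "\<nu> i"] sets_eq_imp_space_eq[OF sets] by (simp add: space_restrict_space)
    then show ?thesis using ab by auto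
  qed
  then obtain l u where box: "\<And>i. i \<in> {1..d} \<Longrightarrow> \<Omega> i = {l i..u i} \<and> l i \<le> u i"
    by metis
  interpret box_marginals d \<Omega> l u \<nu>
    by unfold_locales (use box assms(1,6) in auto)
  have "continuous_on {0..} (relaxed_value d \<Omega> \<nu> f)"
    if order: "\<forall>i\<in>{1..<d}. convex_order (\<nu> i) (\<nu> (Suc i))"
  proof -
    obtain \<pi> where "\<pi> \<in> martingales" "\<pi> \<in> transports"
      using strassen[OF assms(4)] order by blast
    then have "relaxed 0 \<noteq> {}" using relaxed_zeroI by blast
    then show ?thesis by (rule continuous_value_from_zero[OF assms(5)])
  qed
  then show ?thesis
    using concave_value[OF assms(5)] continuous_value[OF assms(5)] by blast
qed

end
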